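(* Let $m,n\ge 2$ and let $G(m,n)=P_m\times P_n$ be the $m\times n$ grid graph (Cartesian product of the paths on $m$ and $n$ vertices). Then the $(mn-3)$-dimensional total $2$-cut complex $\Delta_2^t(G(m,n))$ is homotopy equivalent to a wedge of $(m-1)(n-1)$ spheres of dimension $mn-4$.
   Context: For a graph $G$, the total $2$-cut complex $\Delta_2^t(G)$ is the simplicial complex on $V(G)$ whose facets are the sets $V(G)\setminus\{a,b\}$ where $a\ne b$ and $ab$ is not an edge of $G$. *)

theory Defs
  imports "HOL-Analysis.Analysis"
begin

section \<open>Finite simple graphs\<close>

record 'a ugraph =
  verts :: "'a set"
  edges :: "'a set set"

definition path_graph :: "nat \<Rightarrow> nat ugraph" where
  "path_graph n = \<lparr>verts = {..<n}, edges = {{i, Suc i} | i. Suc i < n}\<rparr>"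

definition cartesian_product :: "'a ugraph \<Rightarrow> 'b ugraph \<Rightarrow> ('a \<times> 'b) ugraph" where
  "cartesian_product G H =
     \<lparr>verts = verts G \<times> verts H,
      edges = {{(u, w), (u', w)} | u u' w. {u, u'} \<in> edges G \<and> w \<in> verts H}
            \<union> {{(u, w), (u, w')} | u w w'. u \<in> verts G \<and> {w, w'} \<in> edges H}\<rparr>"

definition grid_graph :: "nat \<Rightarrow> nat \<Rightarrow> (nat \<times> nat) ugraph" where
  "grid_graph m n = cartesian_product (path_graph m) (path_graph n)"


section \<open>Abstract simplicial complexes\<close>

text \<open>A complex is given by its set of faces, the empty face included. (The constant
  \<^const>\<open>simplicial_complex\<close> of the library is about geometric complexes.)\<close>

definition complex_generated_by :: "'a set set \<Rightarrow> 'a set set" where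
  "complex_generated_by F = {\<sigma>. \<exists>\<tau>\<in>F. \<sigma> \<subseteq> \<tau>}"

definition facets :: "'a set set \<Rightarrow> 'a set set" where
  "facets K = {\<sigma> \<in> K. \<forall>\<tau>\<in>K. \<sigma> \<subseteq> \<tau> \<longrightarrow> \<sigma> = \<tau>}"

definition complex_dim :: "'a set set \<Rightarrow> int" where
  "complex_dim K = int (Max (card ` K)) - 1"

text \<open>Points of the geometric realization are given by their barycentric coordinates. The
  product topology used here is the usual (weak) topology because only finite complexes are
  considered. The empty face contributes no point.\<close>

definition geometric_realization :: "'a set set \<Rightarrow> ('a \<Rightarrow> real) topology" where
  "geometric_realization K =
     subtopology (powertop_real UNIV)
       {x. (\<forall>v. 0 \<le> x v) \<and> {v. x v \<noteq> 0} \<in> K \<and> (\<Sum>v | x v \<noteq> 0. x v) = 1}"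

definition total_2_cut_complex :: "'a ugraph \<Rightarrow> 'a set set" where
  "total_2_cut_complex G =
     complex_generated_by
       {verts G - {a, b} | a b. a \<in> verts G \<and> b \<in> verts G \<and> a \<noteq> b \<and> {a, b} \<notin> edges G}"

lemma facets_total_2_cut_complex:
  assumes fin: "finite (verts G)"
  shows "facets (total_2_cut_complex G) =
     {verts G - {a, b} | a b. a \<in> verts G \<and> b \<in> verts G \<and> a \<noteq> b \<and> {a, b} \<notin> edges G}"
    (is "_ = ?F")
proof -
  have max: "\<sigma> = \<rho>" if "\<sigma> \<in> F" "\<tau> \<in> F" "\<sigma> \<subseteq> \<rho>" "\<rho> \<subseteq> \<tau>"
      and F: "\<And>\<tau>. \<tau> \<in> F \<Longrightarrow> finite \<tau> \<and> card \<tau> = k" for \<sigma> \<rho> \<tau> :: "'a set" and F k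
  proof -
    have "\<sigma> = \<tau>"
      using that(3,4) F[OF that(1)] F[OF that(2)] by (intro card_subset_eq) auto
    with that(3,4) show ?thesis by blast
  qed
  have gen: "facets (complex_generated_by F) = F"
    if F: "\<And>\<tau>. \<tau> \<in> F \<Longrightarrow> finite \<tau> \<and> card \<tau> = k" for F :: "'a set set" and k
  proof (rule set_eqI)
    fix \<sigma>
    show "\<sigma> \<in> facets (complex_generated_by F) \<longleftrightarrow> \<sigma> \<in> F"
    proof
      assume *: "\<sigma> \<in> facets (complex_generated_by F)"
      then obtain \<tau> where \<tau>: "\<tau> \<in> F" "\<sigma> \<subseteq> \<tau>"
        unfolding facets_def complex_generated_by_def by blast
      then have "\<tau> \<in> complex_generated_by F"
        unfolding complex_generated_by_def by blast
      with * \<tau> have "\<sigma> = \<tau>"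
        unfolding facets_def by blast
      with \<tau> show "\<sigma> \<in> F" by simp
    next
      assume \<sigma>: "\<sigma> \<in> F"
      show "\<sigma> \<in> facets (complex_generated_by F)"
        unfolding facets_def complex_generated_by_def
        using \<sigma> max[OF \<sigma> _ _ _ F] by blast
    qed
  qed
  have "finite \<tau> \<and> card \<tau> = card (verts G) - 2" if "\<tau> \<in> ?F" for \<tau>
  proof -
    from that obtain a b where "\<tau> = verts G - {a, b}" "{a, b} \<subseteq> verts G" "a \<noteq> b"
      by blast
    with fin show ?thesis
      by (simp add: card_Diff_subset)
  qed
  then show ?thesis
    unfolding total_2_cut_complex_def by (rule gen)
qed


section \<open>Wedges of pointed spaces\<close>

text \<open>The wedge is the quotient of the disjoint union in which all base points are identified;
  \<^const>\<open>None\<close> is the common base point. For the empty family this is a one-point space.\<close>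

definition wedge_proj :: "('i \<Rightarrow> 'a) \<Rightarrow> 'i \<times> 'a \<Rightarrow> ('i \<times> 'a) option" where
  "wedge_proj p z = (if snd z = p (fst z) then None else Some z)"

definition wedge :: "('i \<Rightarrow> 'a topology) \<Rightarrow> ('i \<Rightarrow> 'a) \<Rightarrow> 'i set \<Rightarrow> ('i \<times> 'a) option topology" where
  "wedge X p I =
     topology (\<lambda>U. U \<subseteq> insert None (wedge_proj p ` topspace (sum_topology X I)) \<and>
       openin (sum_topology X I) {z \<in> topspace (sum_topology X I). wedge_proj p z \<in> U})"

lemma openin_wedge:
  "openin (wedge X p I) U \<longleftrightarrow>
     U \<subseteq> insert None (wedge_proj p ` topspace (sum_topology X I)) \<and>
     openin (sum_topology X I) {z \<in> topspace (sum_topology X I). wedge_proj p z \<in> U}"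
proof -
  let ?S = "sum_topology X I"
  let ?pre = "\<lambda>U. {z \<in> topspace ?S. wedge_proj p z \<in> U}"
  have "istopology (\<lambda>U. U \<subseteq> insert None (wedge_proj p ` topspace ?S) \<and> openin ?S (?pre U))"
    unfolding istopology_def
  proof (intro conjI allI impI)
    fix A B
    assume "A \<subseteq> insert None (wedge_proj p ` topspace ?S) \<and> openin ?S (?pre A)"
      and "B \<subseteq> insert None (wedge_proj p ` topspace ?S) \<and> openin ?S (?pre B)"
    moreover have "?pre (A \<inter> B) = ?pre A \<inter> ?pre B" by blast
    ultimately show "A \<inter> B \<subseteq> insert None (wedge_proj p ` topspace ?S)"
      and "openin ?S (?pre (A \<inter> B))" by auto
  next
    fix \<K>
    assume *: "\<forall>K\<in>\<K>. K \<subseteq> insert None (wedge_proj p ` topspace ?S) \<and> openin ?S (?pre K)"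
    have "?pre (\<Union>\<K>) = (\<Union>K\<in>\<K>. ?pre K)" by blast
    with * show "openin ?S (?pre (\<Union>\<K>))" by auto
    from * show "\<Union>\<K> \<subseteq> insert None (wedge_proj p ` topspace ?S)" by blast
  qed
  then show ?thesis
    by (simp add: wedge_def)
qed

lemma topspace_wedge:
  "topspace (wedge X p I) = insert None (wedge_proj p ` topspace (sum_topology X I))"
proof -
  let ?T = "insert None (wedge_proj p ` topspace (sum_topology X I))"
  have "{z \<in> topspace (sum_topology X I). wedge_proj p z \<in> ?T} = topspace (sum_topology X I)"
    by blast
  then have "openin (wedge X p I) ?T"
    unfolding openin_wedge by (metis openin_topspace order_refl)
  then show ?thesis
    using openin_subset[of "wedge X p I" ?T] openin_topspace[of "wedge X p I"]
    unfolding openin_wedge by blast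
qed

lemma quotient_map_wedge_proj:
  assumes "I \<noteq> {}" and p: "\<And>i. i \<in> I \<Longrightarrow> p i \<in> topspace (X i)"
  shows "quotient_map (sum_topology X I) (wedge X p I) (wedge_proj p)"
proof -
  from assms obtain i where "i \<in> I" "p i \<in> topspace (X i)" by blast
  then have "None \<in> wedge_proj p ` topspace (sum_topology X I)"
    by (intro image_eqI[where x = "(i, p i)"]) (auto simp: wedge_proj_def)
  then have "insert None (wedge_proj p ` topspace (sum_topology X I)) =
      wedge_proj p ` topspace (sum_topology X I)"
    by (rule insert_absorb)
  then show ?thesis
    by (simp add: quotient_map_def topspace_wedge openin_wedge)
qed

definition wedge_of_spheres :: "nat \<Rightarrow> nat \<Rightarrow> (nat \<times> (nat \<Rightarrow> real)) option topology" where
  "wedge_of_spheres k d =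
     wedge (\<lambda>_. nsphere d) (\<lambda>_ i. if i = 0 then 1 else 0) {..<k}"

end

theory Submission
  imports Defs
begin

text \<open>A set of vertices is a face of the total 2-cut complex iff its complement is not a clique.
  Fix the corner \<open>p = (0, 0)\<close> of the grid and a spanning tree containing all edges at \<open>p\<close>. The
  closed star of \<open>p\<close> is a cone; as the grid is triangle-free, the other faces are the complements of
  \<open>{p, v}\<close> with \<open>v\<close> not adjacent to \<open>p\<close>, and of \<open>{p} \<union> e\<close> with \<open>e\<close> an edge avoiding \<open>p\<close>. Matching
  \<open>v\<close> with the tree edge from \<open>v\<close> towards \<open>p\<close> and collapsing these pairs, nearest to the root first,
  leaves the cone together with one simplex of dimension \<open>m n - 4\<close>, attached along its boundary,
  for each of the \<open>(m - 1) (n - 1)\<close> edges outside the tree. Shrinking the cone to a point turns this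
  into the wedge of spheres.\<close>

section \<open>Maps out of wedges and contractible collapses\<close>

text \<open>Why so few faces lie outside the star: in a triangle-free graph any three vertices
  contain a non-adjacent pair, so adding \<open>p\<close> can destroy a face only if at most two
  other vertices are missing from it. The cells that survive the collapses are counted by the cycle
  rank of the graph, edges minus vertices plus one; each is the complement of three vertices, hence
  of dimension \<open>m * n - 4\<close>. The obstacle is the passage to the quotient. Contracting
  the cone inside itself is easy, but a homotopy equivalence with the quotient requires a homotopy
  of the whole complex extending that contraction. It is written down explicitly in barycentric
  coordinates, as are the collapses. The tool throughout is the least coordinate on a face \<sigma>:
  it is continuous, and it vanishes exactly at the points whose support does not contain \<sigma>,
  so one global formula can act on chosen cells only.\<close>

lemma continuous_map_wedge_inclusion:
  assumes "i \<in> I"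
  shows "continuous_map (X i) (wedge X p I) (\<lambda>x. wedge_proj p (i, x))"
  unfolding continuous_map_def
proof (intro conjI allI impI)
  show "(\<lambda>x. wedge_proj p (i, x)) \<in> topspace (X i) \<rightarrow> topspace (wedge X p I)"
    using assms by (auto simp: topspace_wedge)
  fix U assume "openin (wedge X p I) U"
  then have "openin (X i) {x. (i, x) \<in> {z \<in> topspace (sum_topology X I). wedge_proj p z \<in> U}}"
    using assms unfolding openin_wedge openin_sum_topology by blast
  with assms show "openin (X i) {x \<in> topspace (X i). wedge_proj p (i, x) \<in> U}"
    by simp
qed

text \<open>The universal property, read off the open sets directly so that the empty family is
  covered too; its wedge is the single point \<open>None\<close>, whence the separate assumption
  \<open>base\<close>.\<close>

lemma continuous_map_from_wedge:
  assumes base: "f None \<in> topspace Y"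
    and cont: "\<And>i. i \<in> I \<Longrightarrow> continuous_map (X i) Y (\<lambda>x. f (wedge_proj p (i, x)))"
  shows "continuous_map (wedge X p I) Y f"
  unfolding continuous_map_def
proof (intro conjI allI impI)
  show "f \<in> topspace (wedge X p I) \<rightarrow> topspace Y"
    using base continuous_map_funspace[OF cont] by (auto simp: topspace_wedge Pi_iff)
  fix U assume "openin Y U"
  then have "openin (X i) {x \<in> topspace (X i). f (wedge_proj p (i, x)) \<in> U}" if "i \<in> I" for i
    using cont[OF that] by (simp add: continuous_map_def)
  moreover have "{z \<in> topspace (sum_topology X I). wedge_proj p z \<in> {w \<in> topspace (wedge X p I). f w \<in> U}}
      = (SIGMA i:I. {x \<in> topspace (X i). f (wedge_proj p (i, x)) \<in> U})"
    unfolding topspace_wedge by auto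
  ultimately show "openin (wedge X p I) {w \<in> topspace (wedge X p I). f w \<in> U}"
    unfolding openin_wedge topspace_wedge[symmetric] by (simp add: openin_disjoint_union Collect_restrict del: topspace_sum_topology)
qed

text \<open>The wedge maps injectively into the product, each summand going to its coordinate axis.\<close>

lemma Hausdorff_space_wedge:
  assumes H: "\<And>i. i \<in> I \<Longrightarrow> Hausdorff_space (X i)"
    and p: "\<And>i. i \<in> I \<Longrightarrow> p i \<in> topspace (X i)"
  shows "Hausdorff_space (wedge X p I)"
proof -
  define f where "f w = (\<lambda>j\<in>I. case w of None \<Rightarrow> p j | Some (i, x) \<Rightarrow> if i = j then x else p j)" for w
  have f_proj: "f (wedge_proj p (i, x)) = (\<lambda>j\<in>I. if i = j then x else p j)" for i x
    by (auto simp: f_def wedge_proj_def)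
  have "continuous_map (wedge X p I) (product_topology X I) f"
  proof (rule continuous_map_from_wedge)
    show "f None \<in> topspace (product_topology X I)"
      using p by (auto simp: f_def)
    fix i assume "i \<in> I"
    show "continuous_map (X i) (product_topology X I) (\<lambda>x. f (wedge_proj p (i, x)))"
      unfolding f_proj continuous_map_componentwise
    proof (intro conjI ballI)
      fix j assume "j \<in> I"
      show "continuous_map (X i) (X j) (\<lambda>x. (\<lambda>j\<in>I. if i = j then x else p j) j)"
        using p \<open>j \<in> I\<close> by (cases "i = j") auto
    qed auto
  qed
  moreover have "inj_on f (topspace (wedge X p I))"
  proof (rule inj_onI)
    fix w w' assume w: "w \<in> topspace (wedge X p I)" "w' \<in> topspace (wedge X p I)" and eq: "f w = f w'"
    have some: "fst z \<in> I" "snd z \<noteq> p (fst z)" "f (Some z) (fst z) = snd z"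
        "f None (fst z) = p (fst z)" "fst z' \<noteq> fst z \<Longrightarrow> f (Some z') (fst z) = p (fst z)"
      if "Some z \<in> topspace (wedge X p I)" for z z'
      using that by (auto simp: f_def topspace_wedge wedge_proj_def split: if_splits prod.splits)
    show "w = w'"
    proof (cases w; cases w')
      fix z z' assume zz: "w = Some z" "w' = Some z'"
      have "fst z = fst z'" "snd z = snd z'"
        using w eq some unfolding zz by metis+
      then show ?thesis by (simp add: zz prod_eq_iff)
    qed (use w eq some in metis)+
  qed
  moreover have "Hausdorff_space (product_topology X I)"
    using H by (simp add: Hausdorff_space_product_topology)
  ultimately show ?thesis
    using Hausdorff_space_injective_preimage by blast
qed

text \<open>The homotopy \<open>h\<close> extends a contraction of \<open>A\<close> within itself,
  which replaces an appeal to the homotopy extension property. Its end map is constant on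
  \<open>A\<close> and so factors through \<open>q\<close> as a map \<open>g\<close>;
  \<open>h\<close> joins the identity to \<open>g \<circ> q\<close>, and its descent to
  \<open>W\<close> joins the identity to \<open>q \<circ> g\<close>.\<close>

lemma homotopy_equivalent_space_collapse_contractible:
  assumes X: "compact_space X" and W: "Hausdorff_space W"
    and q: "continuous_map X W q" "q ` topspace X = topspace W"
    and h: "continuous_map (prod_topology (top_of_set {0..1::real}) X) X h"
    and h0: "\<And>x. x \<in> topspace X \<Longrightarrow> h (0, x) = x"
    and hA: "\<And>t x. t \<in> {0..1} \<Longrightarrow> x \<in> A \<Longrightarrow> h (t, x) \<in> A"
    and h1: "\<And>x. x \<in> A \<Longrightarrow> h (1, x) = a"
    and qA: "\<And>x. x \<in> A \<Longrightarrow> q x = b"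
    and inj: "\<And>x y. x \<in> topspace X \<Longrightarrow> y \<in> topspace X \<Longrightarrow> q x = q y \<Longrightarrow> x = y \<or> (x \<in> A \<and> y \<in> A)"
  shows "X homotopy_equivalent_space W"
proof -
  let ?I = "top_of_set {0..1::real}"
  have quot: "quotient_map X W q"
    using continuous_closed_imp_quotient_map[OF q(1) _ q(2)]
      continuous_imp_closed_map_gen[OF X Hausdorff_imp_kc_space[OF W] q(1)] by blast
  have cont1: "continuous_map X X (\<lambda>x. h (1, x))"
    using continuous_map_o_Pair[OF h, of 1] by (simp add: o_def)
  have fib1: "h (1, x) = h (1, y)" if "x \<in> topspace X" "y \<in> topspace X" "q x = q y" for x y
    using inj[OF that] h1[of x] h1[of y] by auto
  have "\<exists>g. continuous_map W X g \<and> (\<forall>x\<in>topspace X. g (q x) = h (1, x))"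
    by (rule quotient_map_lift_exists[OF quot cont1 fib1]) auto
  then obtain g where g: "continuous_map W X g"
      and gq: "\<And>x. x \<in> topspace X \<Longrightarrow> g (q x) = h (1, x)"
    by blast
  have hX: "homotopic_with (\<lambda>x. True) X X id (g \<circ> q)"
    using h h0 gq by (subst homotopic_with) auto
  \<comment> \<open>The interval is locally compact, so multiplying by it preserves quotient maps;
    this lets a homotopy on \<open>X\<close> descend to \<open>W\<close>.\<close>
  have quotI: "quotient_map (prod_topology ?I X) (prod_topology ?I W) (\<lambda>(t, x). (t, q x))"
  proof (rule quotient_map_prod_right[OF _ _ quot])
    show "locally_compact_space ?I"
      by (simp add: compact_imp_locally_compact_space compact_space_subtopology)
    show "Hausdorff_space ?I \<or> regular_space ?I"
      by (simp add: Hausdorff_space_subtopology)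
  qed
  have cont: "continuous_map (prod_topology ?I X) W (q \<circ> h)"
    using h q(1) by (rule continuous_map_compose)
  have fib: "(q \<circ> h) z = (q \<circ> h) z'"
    if z: "z \<in> topspace (prod_topology ?I X)" "z' \<in> topspace (prod_topology ?I X)"
      and eq: "(\<lambda>(t, x). (t, q x)) z = (\<lambda>(t, x). (t, q x)) z'" for z z'
  proof -
    obtain t x t' x' where [simp]: "z = (t, x)" "z' = (t', x')" by (cases z; cases z')
    have "t' = t" "q x = q x'" "t \<in> {0..1}" "x \<in> topspace X" "x' \<in> topspace X"
      using z eq by auto
    \<comment> \<open>Distinct points of one fibre lie in \<open>A\<close>, stay there under
      \<open>h\<close>, and are both sent to \<open>b\<close>.\<close>
    moreover from this have "x = x' \<or> q (h (t, x)) = b \<and> q (h (t, x')) = b"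
      using inj[of x x'] qA[OF hA[of t x]] qA[OF hA[of t x']] by blast
    ultimately show ?thesis by auto
  qed
  have "\<exists>k. continuous_map (prod_topology ?I W) W k \<and>
      (\<forall>z\<in>topspace (prod_topology ?I X). k ((\<lambda>(t, x). (t, q x)) z) = (q \<circ> h) z)"
    by (rule quotient_map_lift_exists[OF quotI cont fib]) blast+
  then obtain k where k: "continuous_map (prod_topology ?I W) W k"
      and k_eq: "\<forall>z\<in>topspace (prod_topology ?I X). k ((\<lambda>(t, x). (t, q x)) z) = (q \<circ> h) z"
    by blast
  have kq: "k (t, q x) = q (h (t, x))" if "t \<in> {0..1}" "x \<in> topspace X" for t x
    using bspec[OF k_eq, of "(t, x)"] that by simp
  have "k (0, w) = w \<and> k (1, w) = q (g w)" if w: "w \<in> topspace W" for w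
  proof -
    obtain x where "x \<in> topspace X" "w = q x" using w unfolding q(2)[symmetric] by blast
    then show ?thesis using kq[of _ x] h0 gq by simp
  qed
  then have "homotopic_with (\<lambda>x. True) W W id (q \<circ> g)"
    using k by (subst homotopic_with) auto
  with hX show ?thesis
    unfolding homotopy_equivalent_space_def
    using g q(1) by (intro exI[of _ q] exI[of _ g]) (simp add: homotopic_with_sym)
qed


section \<open>Geometric realizations and elementary collapses\<close>

lemma topspace_geometric_realization:
  "topspace (geometric_realization K) =
     {x. (\<forall>v. 0 \<le> x v) \<and> {v. x v \<noteq> 0} \<in> K \<and> (\<Sum>v | x v \<noteq> 0. x v) = 1}"
  by (simp add: geometric_realization_def)

lemma in_geometric_realization_iff:
  assumes "finite V" and "K \<subseteq> Pow V"
  shows "x \<in> topspace (geometric_realization K) \<longleftrightarrow>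
    (\<forall>v. 0 \<le> x v) \<and> {v. x v \<noteq> 0} \<in> K \<and> sum x V = 1"
proof -
  have "(\<Sum>v | x v \<noteq> 0. x v) = sum x V" if "{v. x v \<noteq> 0} \<in> K"
    using assms that by (intro sum.mono_neutral_left) auto
  then show ?thesis
    by (auto simp: topspace_geometric_realization)
qed

lemma continuous_map_geometric_realization_coord:
  "continuous_map (geometric_realization K) euclideanreal (\<lambda>x. x v)"
  unfolding geometric_realization_def
  by (intro continuous_map_from_subtopology continuous_map_product_projection) simp

lemma continuous_map_into_geometric_realization:
  assumes "\<And>v. continuous_map Z euclideanreal (\<lambda>z. f z v)"
    and "\<And>z. z \<in> topspace Z \<Longrightarrow> f z \<in> topspace (geometric_realization K)"
  shows "continuous_map Z (geometric_realization K) f"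
  unfolding geometric_realization_def
  by (rule continuous_map_into_subtopology)
    (use assms in \<open>auto simp: continuous_map_componentwise_UNIV topspace_geometric_realization\<close>)

lemma continuous_map_real_Min:
  assumes "finite I" "I \<noteq> {}" and "\<And>i. i \<in> I \<Longrightarrow> continuous_map X euclideanreal (\<lambda>x. f x i)"
  shows "continuous_map X euclideanreal (\<lambda>x. Min (f x ` I))"
  using assms
proof (induction rule: finite_ne_induct)
  case (insert i I)
  then have "continuous_map X euclideanreal (\<lambda>x. min (f x i) (Min (f x ` I)))"
    by (intro continuous_map_real_min) auto
  with insert show ?case by simp
qed simp

lemma Min_image_attained:
  assumes "finite I" "I \<noteq> {}"
  obtains i where "i \<in> I" "f i = Min (f ` I)"
proof -
  have "Min (f ` I) \<in> f ` I"
    using assms by (intro Min_in) auto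
  then show thesis
    using that by (elim imageE) simp
qed

lemma Min_coord_eq_0_iff:
  assumes "finite \<sigma>" "\<sigma> \<noteq> {}" and "\<And>v. 0 \<le> x v"
  shows "Min (x ` \<sigma>) = (0::real) \<longleftrightarrow> \<not> \<sigma> \<subseteq> {v. x v \<noteq> 0}"
proof
  assume "Min (x ` \<sigma>) = 0"
  then show "\<not> \<sigma> \<subseteq> {v. x v \<noteq> 0}"
    using Min_in[of "x ` \<sigma>"] assms(1,2) by auto
next
  assume "\<not> \<sigma> \<subseteq> {v. x v \<noteq> 0}"
  then obtain v where "v \<in> \<sigma>" "x v = 0" by auto
  then have "Min (x ` \<sigma>) \<le> 0"
    using assms(1) by (metis Min_le finite_imageI image_eqI)
  moreover have "0 \<le> Min (x ` \<sigma>)"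
    using assms by simp
  ultimately show "Min (x ` \<sigma>) = 0" by simp
qed

lemma closedin_geometric_realization_face:
  shows "closedin (geometric_realization K)
    {x \<in> topspace (geometric_realization K). {v. x v \<noteq> 0} \<subseteq> \<sigma>}"
proof -
  \<comment> \<open>The extra index \<open>v0\<close> keeps the intersection nonempty when \<sigma>
    contains every vertex; inside \<sigma> the value \<open>UNIV\<close> imposes no
    condition.\<close>
  have "closedin (geometric_realization K) (\<Inter>v\<in>insert v0 (-\<sigma>).
      {x \<in> topspace (geometric_realization K). x v \<in> (if v \<in> \<sigma> then UNIV else {0})})" for v0
    by (intro closedin_INT closedin_continuous_map_preimage[OF continuous_map_geometric_realization_coord]) auto
  moreover have "(\<Inter>v\<in>insert v0 (-\<sigma>).
      {x \<in> topspace (geometric_realization K). x v \<in> (if v \<in> \<sigma> then UNIV else {0})})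
      = {x \<in> topspace (geometric_realization K). {v. x v \<noteq> 0} \<subseteq> \<sigma>}" for v0
    by auto
  ultimately show ?thesis by metis
qed

text \<open>Closure under subsets makes the realization a finite union of closed simplices, each
  closed in the product and contained in a cube that is compact by Tychonoff.\<close>

lemma compact_space_geometric_realization:
  assumes V: "finite V" and K: "K \<subseteq> Pow V"
    and closed: "\<And>\<sigma> \<tau>. \<tau> \<in> K \<Longrightarrow> \<sigma> \<subseteq> \<tau> \<Longrightarrow> \<sigma> \<in> K"
  shows "compact_space (geometric_realization K)"
proof -
  let ?P = "powertop_real (UNIV :: 'a set)"
  have proj: "continuous_map ?P euclideanreal (\<lambda>x. x v)" for v
    by (rule continuous_map_product_projection) simp
  define F where "F \<sigma> = {x \<in> topspace ?P. sum x V \<in> {1}} \<inter>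
     (\<Inter>v. {x \<in> topspace ?P. x v \<in> (if v \<in> \<sigma> then {0..} else {0})})" for \<sigma>
  have "closedin ?P (F \<sigma>)" for \<sigma>
    unfolding F_def
  proof (rule closedin_Int)
    show "closedin ?P {x \<in> topspace ?P. sum x V \<in> {1}}"
      using V by (intro closedin_continuous_map_preimage[OF continuous_map_sum] proj) auto
    show "closedin ?P (\<Inter>v. {x \<in> topspace ?P. x v \<in> (if v \<in> \<sigma> then {0..} else {0})})"
      by (intro closedin_INT closedin_continuous_map_preimage[OF proj]) auto
  qed
  moreover have "finite K"
    using V K finite_subset by blast
  ultimately have "closedin ?P (\<Union>\<sigma>\<in>K. F \<sigma>)"
    by (intro closedin_Union) auto
  moreover have "(\<Union>\<sigma>\<in>K. F \<sigma>) = topspace (geometric_realization K)"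
  proof (rule set_eqI)
    fix x
    have F: "x \<in> F \<sigma> \<longleftrightarrow> (\<forall>v. 0 \<le> x v) \<and> {v. x v \<noteq> 0} \<subseteq> \<sigma> \<and> sum x V = 1" for \<sigma>
      by (auto simp: F_def) (metis order_refl)
    show "x \<in> (\<Union>\<sigma>\<in>K. F \<sigma>) \<longleftrightarrow> x \<in> topspace (geometric_realization K)"
      unfolding in_geometric_realization_iff[OF V K] UN_iff F using closed by blast
  qed
  moreover have "compactin ?P (PiE UNIV (\<lambda>_. {0..1::real}))"
    by (simp add: compactin_PiE)
  moreover have "topspace (geometric_realization K) \<subseteq> PiE UNIV (\<lambda>_. {0..1})"
  proof
    fix x assume "x \<in> topspace (geometric_realization K)"
    then have x: "\<And>v. 0 \<le> x v" "{v. x v \<noteq> 0} \<in> K" "sum x V = 1"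
      by (auto simp: in_geometric_realization_iff[OF V K])
    have "x v \<le> 1" for v
      using x member_le_sum[of v V x] V K x(2) by (cases "x v = 0") auto
    with x(1) show "x \<in> PiE UNIV (\<lambda>_. {0..1})" by auto
  qed
  ultimately have "compactin ?P (topspace (geometric_realization K))"
    using closed_compactin by metis
  then show ?thesis
    by (simp add: compactin_subspace geometric_realization_def)
qed

text \<open>Let \<open>m x\<close> be the least coordinate of \<open>x\<close> on \<open>\<sigma>\<close>, which vanishes unless \<open>x\<close> lies in the
  interior of \<open>\<sigma>\<close> or of \<open>insert a \<sigma>\<close>. Transporting the mass \<open>m x\<close> from every vertex of \<open>\<sigma>\<close>
  to \<open>a\<close> is a deformation retraction.\<close>

lemma homotopy_equivalent_elementary_collapse:
  assumes V: "finite V" and K: "K \<subseteq> Pow V"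
    and \<sigma>: "\<sigma> \<noteq> {}" "a \<notin> \<sigma>" "\<sigma> \<in> K" "insert a \<sigma> \<in> K"
    and free: "\<And>\<rho>. \<rho> \<in> K \<Longrightarrow> \<sigma> \<subseteq> \<rho> \<Longrightarrow> \<rho> = \<sigma> \<or> \<rho> = insert a \<sigma>"
    and closed: "\<And>\<rho>. \<rho> \<subseteq> insert a \<sigma> \<Longrightarrow> \<not> \<sigma> \<subseteq> \<rho> \<Longrightarrow> \<rho> \<in> K"
  shows "geometric_realization K homotopy_equivalent_space
    geometric_realization (K - {\<sigma>, insert a \<sigma>})"
proof -
  let ?L = "K - {\<sigma>, insert a \<sigma>}" and ?I = "top_of_set {0..1::real}"
  have sub: "\<sigma> \<subseteq> V" "a \<in> V"
    using K \<sigma>(4) by auto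
  have fin: "finite \<sigma>"
    using V sub(1) finite_subset by blast
  define m where "m x = Min (x ` \<sigma>)" for x :: "'a \<Rightarrow> real"
  \<comment> \<open>The factor \<open>card \<sigma>\<close> makes \<open>a\<close> receive exactly
    what the vertices of \<sigma> lose, so the coordinate sum is preserved.\<close>
  define h where "h z v = snd z v - fst z * m (snd z) * of_bool (v \<in> \<sigma>)
      + fst z * (card \<sigma> * m (snd z)) * of_bool (v = a)" for z :: "real \<times> ('a \<Rightarrow> real)" and v
  note iff = in_geometric_realization_iff[OF V K]
  have L: "?L \<subseteq> Pow V" using K by blast
  note iffL = in_geometric_realization_iff[OF V L]
  have m_le: "m x \<le> x v" if "v \<in> \<sigma>" for x v
    using fin that by (simp add: m_def)
  have m_ge: "0 \<le> m x" if "\<And>v. 0 \<le> x v" for x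
    using fin \<sigma> that by (simp add: m_def)
  have m0: "h (t, x) = x" if "m x = 0" for t x
    using that by (auto simp: h_def)
  have sum_h: "sum (h (t, x)) V = sum x V" for t x
  proof -
    have "sum (h (t, x)) V = sum x V - (\<Sum>v\<in>V. t * m x * of_bool (v \<in> \<sigma>))
        + (\<Sum>v\<in>V. t * (card \<sigma> * m x) * of_bool (v = a))"
      by (simp add: h_def sum.distrib sum_subtractf)
    also have "(\<Sum>v\<in>V. t * m x * of_bool (v \<in> \<sigma>)) = t * (card \<sigma> * m x)"
      using V sub by (simp add: of_bool_def sum.If_cases Int_absorb1 if_distrib[of "(*) _"] cong: if_cong)
    also have "(\<Sum>v\<in>V. t * (card \<sigma> * m x) * of_bool (v = a)) = t * (card \<sigma> * m x)"
      using V sub by (simp add: of_bool_def if_distrib[of "(*) _"] cong: if_cong)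
    finally show ?thesis by simp
  qed
  have nonneg: "0 \<le> h (t, x) v" if "\<And>v. 0 \<le> x v" "t \<in> {0..1}" for t x v
  proof -
    have "t * m x \<le> m x"
      using that m_ge[of x] by (simp add: mult_left_le_one_le)
    then have "0 \<le> x v - t * m x * of_bool (v \<in> \<sigma>)"
      using m_le[of v x] that by (cases "v \<in> \<sigma>") auto
    moreover have "0 \<le> t * (card \<sigma> * m x) * of_bool (v = a)"
      using that m_ge[of x] by simp
    ultimately show ?thesis by (simp add: h_def)
  qed
  have supp: "{v. h (t, x) v \<noteq> 0} \<in> K" and supp1: "{v. h (1, x) v \<noteq> 0} \<in> ?L"
    if x: "\<And>v. 0 \<le> x v" "{v. x v \<noteq> 0} \<in> K" for t x
  proof -
    show "{v. h (t, x) v \<noteq> 0} \<in> K"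
    proof (cases "m x = 0")
      case True with x m0 show ?thesis by simp
    next
      case False
      then have "\<sigma> \<subseteq> {v. x v \<noteq> 0}"
        using Min_coord_eq_0_iff[OF fin \<sigma>(1) x(1)] by (simp add: m_def)
      then have "{v. x v \<noteq> 0} \<subseteq> insert a \<sigma>"
        using free[OF x(2)] by auto
      then have "{v. h (t, x) v \<noteq> 0} \<subseteq> insert a \<sigma>"
        by (auto simp: h_def split: if_splits)
      moreover have "\<rho> \<in> K" if "\<rho> \<subseteq> insert a \<sigma>" for \<rho>
      proof (cases "\<sigma> \<subseteq> \<rho>")
        case True
        with that have "\<rho> = \<sigma> \<or> \<rho> = insert a \<sigma>" by blast
        with \<sigma> show ?thesis by blast
      qed (use closed that in blast)
      ultimately show ?thesis by blast
    qed
  next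
    have "{v. h (1, x) v \<noteq> 0} \<in> K \<and> \<not> \<sigma> \<subseteq> {v. h (1, x) v \<noteq> 0}"
    proof (cases "m x = 0")
      case True with x m0 show ?thesis
        using Min_coord_eq_0_iff[OF fin \<sigma>(1) x(1)] by (simp add: m_def)
    next
      case False
      then have "\<sigma> \<subseteq> {v. x v \<noteq> 0}"
        using Min_coord_eq_0_iff[OF fin \<sigma>(1) x(1)] by (simp add: m_def)
      then have "{v. x v \<noteq> 0} \<subseteq> insert a \<sigma>"
        using free[OF x(2)] by auto
      then have "{v. h (1, x) v \<noteq> 0} \<subseteq> insert a \<sigma>"
        by (auto simp: h_def split: if_splits)
      \<comment> \<open>A vertex attaining the minimum is emptied at time 1, so the support no
        longer contains \<sigma>.\<close>
      moreover obtain v where v: "v \<in> \<sigma>" "m x = x v"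
        using Min_in[OF finite_imageI[OF fin], of x] \<sigma>(1) by (auto simp: m_def)
      then have "h (1, x) v = 0"
        using \<sigma>(2) by (auto simp: h_def)
      then have "\<not> \<sigma> \<subseteq> {v. h (1, x) v \<noteq> 0}"
        using v by blast
      ultimately show ?thesis using closed by blast
    qed
    then show "{v. h (1, x) v \<noteq> 0} \<in> ?L" by blast
  qed
  have cfst: "continuous_map (prod_topology ?I (geometric_realization K)) euclideanreal fst"
    by (rule continuous_map_into_fulltopology[OF continuous_map_fst])
  have csnd: "continuous_map (prod_topology ?I (geometric_realization K)) euclideanreal (\<lambda>z. snd z v)" for v
    using continuous_map_compose[OF continuous_map_snd continuous_map_geometric_realization_coord]
    by (simp add: o_def)
  have h: "continuous_map (prod_topology ?I (geometric_realization K)) (geometric_realization K) h"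
  proof (rule continuous_map_into_geometric_realization)
    show "continuous_map (prod_topology ?I (geometric_realization K)) euclideanreal (\<lambda>z. h z v)" for v
      unfolding h_def m_def using fin \<sigma>(1)
      by (intro continuous_intros continuous_map_real_Min cfst csnd) auto
  qed (use supp nonneg sum_h in \<open>auto simp: iff\<close>)
  have h1: "continuous_map (geometric_realization K) euclideanreal (\<lambda>x. h (1, x) v)" for v
    unfolding h_def m_def using fin \<sigma>(1)
    by (intro continuous_intros continuous_map_real_Min) (auto simp: continuous_map_geometric_realization_coord)
  have "retraction_maps (geometric_realization K) (geometric_realization ?L) (\<lambda>x. h (1, x)) id"
    unfolding retraction_maps_def
  proof (intro conjI ballI)
    show "continuous_map (geometric_realization K) (geometric_realization ?L) (\<lambda>x. h (1, x))"
    proof (intro continuous_map_into_geometric_realization h1)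
      fix x assume "x \<in> topspace (geometric_realization K)"
      then show "h (1, x) \<in> topspace (geometric_realization ?L)"
        using supp1[of x] nonneg[of x 1] sum_h[of 1 x] unfolding iff iffL by auto
    qed
    show "continuous_map (geometric_realization ?L) (geometric_realization K) id"
      by (intro continuous_map_into_geometric_realization)
        (auto simp: iff iffL continuous_map_geometric_realization_coord)
    fix x assume "x \<in> topspace (geometric_realization ?L)"
    then have x: "\<And>v. 0 \<le> x v" "{v. x v \<noteq> 0} \<in> ?L"
      by (simp_all add: iffL)
    \<comment> \<open>By freeness only the two removed faces contain \<sigma>, so \<open>m\<close>
      vanishes on the smaller complex and \<open>h\<close> fixes it.\<close>
    then have "\<not> \<sigma> \<subseteq> {v. x v \<noteq> 0}"
      using free by blast
    then have "m x = 0"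
      using Min_coord_eq_0_iff[OF fin \<sigma>(1) x(1)] by (simp add: m_def)
    then show "h (1, id x) = x"
      by (simp add: m0)
  qed
  moreover have "homotopic_with (\<lambda>x. True) (geometric_realization K) (geometric_realization K)
      id (\<lambda>x. h (1, x))"
    using h by (subst homotopic_with) (auto simp: h_def fun_eq_iff)
  ultimately show ?thesis
    using deformation_retract_imp_homotopy_equivalent_space homotopic_with_symD by blast
qed


section \<open>The simplex modulo its boundary\<close>

text \<open>Stereographic projection with the denominators cleared: the interior of the simplex
  \<open>y 0 + \<dots> + y D = 1\<close> is identified with Euclidean space by \<open>y \<mapsto> (y j - y 0) / m\<close>,
  \<open>m\<close> being the least coordinate, and the boundary \<open>m = 0\<close> goes to the projection centre.\<close>

definition simplex_to_sphere :: "nat \<Rightarrow> (nat \<Rightarrow> real) \<Rightarrow> nat \<Rightarrow> real" where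
  "simplex_to_sphere D y =
    (let m = Min (y ` {..D}); w = (\<Sum>j\<in>{1..D}. (y j - y 0)\<^sup>2)
     in (\<lambda>j. if j = 0 then (w - m\<^sup>2) / (w + m\<^sup>2)
             else if j \<le> D then 2 * m * (y j - y 0) / (w + m\<^sup>2) else 0))"

lemma atMost_eq_insert_0_Icc: "{..D} = insert 0 {1..D::nat}"
  by auto

text \<open>If both squares vanished, all coordinates would be equal and one of them zero, against
  the sum being 1.\<close>

lemma simplex_to_sphere_denominator_pos:
  fixes y :: "nat \<Rightarrow> real"
  assumes y: "\<And>j. j \<le> D \<Longrightarrow> 0 \<le> y j" "sum y {..D} = 1"
  shows "0 < (\<Sum>j\<in>{1..D}. (y j - y 0)\<^sup>2) + (Min (y ` {..D}))\<^sup>2"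
proof (rule ccontr)
  assume "\<not> ?thesis"
  moreover have "0 \<le> (\<Sum>j\<in>{1..D}. (y j - y 0)\<^sup>2)"
    by (intro sum_nonneg) auto
  ultimately have w: "(\<Sum>j\<in>{1..D}. (y j - y 0)\<^sup>2) = 0" and m: "Min (y ` {..D}) = 0"
    using zero_le_power2[of "Min (y ` {..D})"] by (smt (verit) zero_eq_power2)+
  from w have eq: "y j = y 0" if "j \<le> D" for j
    using that by (cases "j = 0") (auto simp: sum_nonneg_eq_0_iff)
  moreover obtain i where "i \<le> D" "y i = 0"
    using Min_image_attained[of "{..D}" y] m by auto
  ultimately have "y j = 0" if "j \<le> D" for j
    using that by metis
  then have "sum y {..D} = 0" by (intro sum.neutral) auto
  with y(2) show False by simp
qed

lemma simplex_to_sphere_in_nsphere: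
  fixes y :: "nat \<Rightarrow> real"
  assumes y: "\<And>j. j \<le> D \<Longrightarrow> 0 \<le> y j" "sum y {..D} = 1"
  shows "simplex_to_sphere D y \<in> topspace (nsphere D)"
proof -
  define m where "m = Min (y ` {..D})"
  define w where "w = (\<Sum>j\<in>{1..D}. (y j - y 0)\<^sup>2)"
  have pos: "0 < w + m\<^sup>2"
    unfolding m_def w_def using simplex_to_sphere_denominator_pos[OF y] .
  have s: "simplex_to_sphere D y j = (if j = 0 then (w - m\<^sup>2) / (w + m\<^sup>2)
             else if j \<le> D then 2 * m * (y j - y 0) / (w + m\<^sup>2) else 0)" for j
    by (simp add: simplex_to_sphere_def m_def w_def Let_def)
  have "(\<Sum>j\<le>D. (simplex_to_sphere D y j)\<^sup>2) =
      ((w - m\<^sup>2) / (w + m\<^sup>2))\<^sup>2 + (\<Sum>j\<in>{1..D}. (2 * m * (y j - y 0) / (w + m\<^sup>2))\<^sup>2)"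
    by (simp add: s atMost_eq_insert_0_Icc)
  also have "(\<Sum>j\<in>{1..D}. (2 * m * (y j - y 0) / (w + m\<^sup>2))\<^sup>2) = 4 * m\<^sup>2 * w / (w + m\<^sup>2)\<^sup>2"
    by (simp add: w_def power_divide power_mult_distrib sum_distrib_left sum_divide_distrib)
  also have "((w - m\<^sup>2) / (w + m\<^sup>2))\<^sup>2 + 4 * m\<^sup>2 * w / (w + m\<^sup>2)\<^sup>2 = ((w - m\<^sup>2)\<^sup>2 + 4 * m\<^sup>2 * w) / (w + m\<^sup>2)\<^sup>2"
    by (simp add: power_divide add_divide_distrib)
  also have "(w - m\<^sup>2)\<^sup>2 + 4 * m\<^sup>2 * w = (w + m\<^sup>2)\<^sup>2"
    by algebra
  also have "(w + m\<^sup>2)\<^sup>2 / (w + m\<^sup>2)\<^sup>2 = 1"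
    using pos by simp
  finally have "(\<Sum>j\<le>D. (simplex_to_sphere D y j)\<^sup>2) = 1" .
  then show ?thesis
    by (simp add: nsphere s)
qed

lemma simplex_to_sphere_boundary:
  fixes y :: "nat \<Rightarrow> real"
  assumes y: "\<And>j. j \<le> D \<Longrightarrow> 0 \<le> y j" "sum y {..D} = 1" and "Min (y ` {..D}) = 0"
  shows "simplex_to_sphere D y = (\<lambda>j. if j = 0 then 1 else 0)"
  using simplex_to_sphere_denominator_pos[OF y] assms(3)
  by (auto simp: simplex_to_sphere_def Let_def fun_eq_iff)

text \<open>Projecting from the pole back to Euclidean space recovers the coordinates
  \<open>(y j - y 0) / m\<close>, so the formula really is stereographic.\<close>

lemma simplex_to_sphere_interior:
  fixes y :: "nat \<Rightarrow> real"
  assumes y: "\<And>j. j \<le> D \<Longrightarrow> 0 \<le> y j" "sum y {..D} = 1" and m: "0 < Min (y ` {..D})"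
  shows "simplex_to_sphere D y 0 < 1"
    and "j \<le> D \<Longrightarrow> (y j - y 0) / Min (y ` {..D}) =
      (if j = 0 then 0 else simplex_to_sphere D y j / (1 - simplex_to_sphere D y 0))"
proof -
  define m where "m = Min (y ` {..D})"
  define w where "w = (\<Sum>j\<in>{1..D}. (y j - y 0)\<^sup>2)"
  have pos: "0 < w + m\<^sup>2" "m > 0"
    unfolding m_def w_def using simplex_to_sphere_denominator_pos[OF y] m by auto
  have s: "simplex_to_sphere D y j = (if j = 0 then (w - m\<^sup>2) / (w + m\<^sup>2)
             else if j \<le> D then 2 * m * (y j - y 0) / (w + m\<^sup>2) else 0)" for j
    by (simp add: simplex_to_sphere_def m_def w_def Let_def)
  have 1: "1 - simplex_to_sphere D y 0 = 2 * m\<^sup>2 / (w + m\<^sup>2)"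
    using pos by (simp add: s field_simps)
  moreover have "0 < 2 * m\<^sup>2 / (w + m\<^sup>2)"
    using pos by simp
  ultimately show "simplex_to_sphere D y 0 < 1" by linarith
  assume "j \<le> D"
  then show "(y j - y 0) / Min (y ` {..D}) =
      (if j = 0 then 0 else simplex_to_sphere D y j / (1 - simplex_to_sphere D y 0))"
    unfolding 1 using pos by (simp add: s power2_eq_square flip: m_def)
qed

text \<open>Equal images make \<open>y / m\<close> and \<open>z / n\<close> agree up to a common
  shift \<open>c\<close>. Both scaled vectors have minimum 1, which forces \<open>c = 0\<close>;
  comparing coordinate sums then gives \<open>m = n\<close>.\<close>

lemma simplex_to_sphere_inj:
  fixes y z :: "nat \<Rightarrow> real"
  assumes y: "\<And>j. j \<le> D \<Longrightarrow> 0 \<le> y j" "sum y {..D} = 1" "0 < Min (y ` {..D})"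
    and z: "\<And>j. j \<le> D \<Longrightarrow> 0 \<le> z j" "sum z {..D} = 1" "0 < Min (z ` {..D})"
    and eq: "simplex_to_sphere D y = simplex_to_sphere D z" and "i \<le> D"
  shows "y i = z i"
proof -
  define m where "m = Min (y ` {..D})"
  define n where "n = Min (z ` {..D})"
  define c where "c = y 0 / m - z 0 / n"
  have pos: "0 < m" "0 < n" using y z by (auto simp: m_def n_def)
  have shift: "y j / m = z j / n + c" if "j \<le> D" for j
    using simplex_to_sphere_interior(2)[OF y that] simplex_to_sphere_interior(2)[OF z that] eq
    by (simp add: c_def diff_divide_distrib flip: m_def n_def split: if_splits)
  obtain k where k: "k \<le> D" "y k = m"
    using Min_image_attained[of "{..D}" y] by (auto simp: m_def)
  obtain l where l: "l \<le> D" "z l = n"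
    using Min_image_attained[of "{..D}" z] by (auto simp: n_def)
  have "n \<le> z k" "m \<le> y l"
    using k l by (auto simp: m_def n_def)
  then have "1 \<le> z k / n" "1 \<le> y l / m"
    using pos by auto
  moreover have "1 = z k / n + c" "y l / m = 1 + c"
    using shift[OF k(1)] shift[OF l(1)] k(2) l(2) pos by simp_all
  ultimately have "c = 0" by linarith
  then have scale: "y j = m / n * z j" if "j \<le> D" for j
    using shift[OF that] pos by (simp add: field_simps)
  then have "sum y {..D} = m / n * sum z {..D}"
    by (simp add: sum_distrib_left)
  with y z have "m / n = 1" by simp
  with scale[OF \<open>i \<le> D\<close>] show ?thesis by simp
qed

text \<open>The stereographic image \<open>u\<close> of \<open>a\<close> prescribes coordinate
  differences in units of the minimum. Shifting \<open>u\<close> to minimum 1 and dividing by the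
  sum gives the preimage.\<close>

lemma simplex_to_sphere_surj:
  assumes a: "a \<in> topspace (nsphere D)" and ne: "a \<noteq> (\<lambda>j. if j = 0 then 1 else 0)"
  shows "\<exists>y. (\<forall>j. 0 < y j) \<and> sum y {..D} = 1 \<and> simplex_to_sphere D y = a"
proof -
  have sq: "(a 0)\<^sup>2 + (\<Sum>j\<in>{1..D}. (a j)\<^sup>2) = 1" and out: "\<And>j. j > D \<Longrightarrow> a j = 0"
    using a by (auto simp: nsphere atMost_eq_insert_0_Icc)
  have "0 \<le> (\<Sum>j\<in>{1..D}. (a j)\<^sup>2)"
    by (intro sum_nonneg) auto
  with sq have "(a 0)\<^sup>2 \<le> 1" by linarith
  then have "a 0 \<le> 1"
    by (simp add: abs_square_le_1)
  moreover have "a 0 \<noteq> 1"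
  proof
    assume a0: "a 0 = 1"
    with sq have "(\<Sum>j\<in>{1..D}. (a j)\<^sup>2) = 0" by simp
    then have "\<forall>j\<in>{1..D}. a j = 0"
      by (subst (asm) sum_nonneg_eq_0_iff) auto
    then have "a j = (if j = 0 then 1 else 0)" for j
      using out[of j] a0 by (cases "j \<le> D") auto
    with ne show False by auto
  qed
  ultimately have t: "0 < 1 - a 0" by simp
  define u where "u j = (if j = 0 then 0 else a j / (1 - a 0))" for j
  define \<mu> where "\<mu> = Min (u ` {..D})"
  \<comment> \<open>The default 1 beyond \<open>D\<close> keeps \<open>y\<close> positive at every
    index, as the conclusion asks.\<close>
  define z where "z j = (if j \<le> D then 1 + u j - \<mu> else 1)" for j
  define S where "S = sum z {..D}"
  define y where "y j = z j / S" for j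
  have U: "(\<Sum>j\<in>{1..D}. (u j)\<^sup>2) = (1 + a 0) / (1 - a 0)"
  proof -
    have "(\<Sum>j\<in>{1..D}. (u j)\<^sup>2) = (\<Sum>j\<in>{1..D}. (a j)\<^sup>2) / (1 - a 0)\<^sup>2"
      by (simp add: u_def power_divide sum_divide_distrib)
    also have "(\<Sum>j\<in>{1..D}. (a j)\<^sup>2) = (1 + a 0) * (1 - a 0)"
      using sq by (simp add: algebra_simps power2_eq_square)
    finally show ?thesis using t by (simp add: power2_eq_square)
  qed
  have "\<mu> \<le> u j" if "j \<le> D" for j
    using that by (simp add: \<mu>_def)
  then have z: "1 \<le> z j" for j
    by (simp add: z_def)
  have "0 < S"
    unfolding S_def using z by (intro sum_pos) (auto intro: less_le_trans[OF zero_less_one])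
  obtain k where k: "k \<le> D" "u k = \<mu>"
    using Min_image_attained[of "{..D}" u] by (auto simp: \<mu>_def)
  then have "z k = 1" by (simp add: z_def)
  have m: "Min (y ` {..D}) = 1 / S"
    using \<open>0 < S\<close> z \<open>z k = 1\<close> \<open>k \<le> D\<close>
    by (intro Min_eqI) (auto simp: y_def divide_right_mono intro!: image_eqI[of _ _ k])
  have diff: "y j - y 0 = u j / S" if "j \<le> D" for j
    using that by (simp add: y_def z_def u_def flip: diff_divide_distrib)
  have w: "(\<Sum>j\<in>{1..D}. (y j - y 0)\<^sup>2) = (1 + a 0) / (1 - a 0) / S\<^sup>2"
    using U by (simp add: diff power_divide flip: sum_divide_distrib)
  have den: "(\<Sum>j\<in>{1..D}. (y j - y 0)\<^sup>2) + (Min (y ` {..D}))\<^sup>2 = 2 / (1 - a 0) / S\<^sup>2"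
    unfolding w m using t \<open>0 < S\<close> by (simp add: field_simps)
  have num: "(\<Sum>j\<in>{1..D}. (y j - y 0)\<^sup>2) - (Min (y ` {..D}))\<^sup>2 = 2 * a 0 / (1 - a 0) / S\<^sup>2"
    unfolding w m using t \<open>0 < S\<close> by (simp add: field_simps)
  have "simplex_to_sphere D y j = a j" for j
    unfolding simplex_to_sphere_def Let_def den num unfolding m
    using t \<open>0 < S\<close> out[of j] by (auto simp: diff u_def power2_eq_square)
  moreover have "0 < y j" for j
    using z[of j] \<open>0 < S\<close> by (simp add: y_def less_le_trans[OF zero_less_one])
  moreover have "sum y {..D} = 1"
    using \<open>0 < S\<close> by (simp add: y_def S_def flip: sum_divide_distrib)
  ultimately show ?thesis
    by (intro exI[of _ y]) auto
qed

lemma continuous_map_simplex_to_sphere: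
  assumes cont: "\<And>j. j \<le> D \<Longrightarrow> continuous_map X euclideanreal (\<lambda>x. f x j)"
    and nonneg: "\<And>x j. x \<in> topspace X \<Longrightarrow> j \<le> D \<Longrightarrow> 0 \<le> f x j"
    and sum: "\<And>x. x \<in> topspace X \<Longrightarrow> sum (f x) {..D} = 1"
  shows "continuous_map X (nsphere D) (\<lambda>x. simplex_to_sphere D (f x))"
  unfolding nsphere
proof (rule continuous_map_into_subtopology)
  have den: "(\<Sum>j\<in>{1..D}. (f x j - f x 0)\<^sup>2) + (Min (f x ` {..D}))\<^sup>2 \<noteq> 0" if "x \<in> topspace X" for x
    using simplex_to_sphere_denominator_pos[of D "f x"] nonneg sum that by (metis less_irrefl)
  have "continuous_map X euclideanreal (\<lambda>x. simplex_to_sphere D (f x) j)" for j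
  proof -
    consider "j = 0" | "0 < j" "j \<le> D" | "D < j" by linarith
    then show ?thesis
    proof cases
      case 1 then show ?thesis
        unfolding simplex_to_sphere_def Let_def using den
        by (simp del: One_nat_def) (intro continuous_intros continuous_map_real_Min cont; simp)
    next
      case 2 then show ?thesis
        unfolding simplex_to_sphere_def Let_def using den
        by (simp del: One_nat_def) (intro continuous_intros continuous_map_real_Min cont; simp)
    next
      case 3 then show ?thesis
        by (simp add: simplex_to_sphere_def Let_def)
    qed
  qed
  then show "continuous_map X (powertop_real UNIV) (\<lambda>x. simplex_to_sphere D (f x))"
    by (simp add: continuous_map_componentwise_UNIV)
  show "(\<lambda>x. simplex_to_sphere D (f x)) \<in> topspace X \<rightarrow> {x. (\<Sum>i\<le>D. (x i)\<^sup>2) = 1 \<and> (\<forall>i>D. x i = 0)}"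
    using simplex_to_sphere_in_nsphere[OF nonneg sum] by (auto simp: nsphere)
qed


section \<open>Cones with attached simplices\<close>

lemma simplex_to_sphere_cong:
  assumes "\<And>j. j \<le> D \<Longrightarrow> y j = z j"
  shows "simplex_to_sphere D y = simplex_to_sphere D z"
proof -
  have "y ` {..D} = z ` {..D}"
    using assms by (intro image_cong) auto
  moreover have "(\<Sum>j\<in>{1..D}. (y j - y 0)\<^sup>2) = (\<Sum>j\<in>{1..D}. (z j - z 0)\<^sup>2)"
    using assms by (intro sum.cong) auto
  ultimately show ?thesis
    using assms by (auto simp: simplex_to_sphere_def Let_def fun_eq_iff)
qed

lemma Hausdorff_space_nsphere: "Hausdorff_space (nsphere D)"
  unfolding nsphere
  by (intro Hausdorff_space_subtopology) (simp add: Hausdorff_space_product_topology)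

text \<open>Contracting the cone to its apex extends over every attached simplex \<open>R i\<close>: expand it from
  its barycentre by the factor \<open>1 + t\<close>, and let a point that has been pushed out of the simplex
  continue from the boundary point it crossed towards the apex. The quotient by the cone is the wedge.\<close>

lemma homotopy_equivalent_cone_with_cells:
  assumes V: "finite V" "K \<subseteq> Pow V"
    and closed: "\<And>\<sigma> \<tau>. \<tau> \<in> K \<Longrightarrow> \<sigma> \<subseteq> \<tau> \<Longrightarrow> \<sigma> \<in> K"
    and ne: "{} \<in> K" and cone: "\<And>\<sigma>. \<sigma> \<in> K \<Longrightarrow> insert p \<sigma> \<in> K"
    and inj: "inj_on R {..<k}"
    and R: "\<And>i. i < k \<Longrightarrow> R i \<subseteq> V" "\<And>i. i < k \<Longrightarrow> card (R i) = Suc D"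
      "\<And>i. i < k \<Longrightarrow> R i \<notin> K" "\<And>i \<sigma>. i < k \<Longrightarrow> \<sigma> \<subset> R i \<Longrightarrow> \<sigma> \<in> K"
  shows "geometric_realization (K \<union> R ` {..<k}) homotopy_equivalent_space wedge_of_spheres k D"
proof -
  define X where "X = geometric_realization (K \<union> R ` {..<k})"
  let ?I = "top_of_set {0..1::real}"
  define b :: "nat \<Rightarrow> real" where "b = (\<lambda>j. if j = 0 then 1 else 0)"
  define W where "W = wedge (\<lambda>_. nsphere D) (\<lambda>_. b) {..<k}"
  define supp where "supp x = {v. x v \<noteq> 0}" for x :: "'a \<Rightarrow> real"
  have V': "K \<union> R ` {..<k} \<subseteq> Pow V"
    using V R(1) by auto
  have X_iff: "x \<in> topspace X \<longleftrightarrow> (\<forall>v. 0 \<le> x v) \<and> supp x \<in> K \<union> R ` {..<k} \<and> sum x V = 1" for x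
    unfolding X_def supp_def by (rule in_geometric_realization_iff[OF V(1) V'])
  have closed': "\<sigma> \<in> K \<union> R ` {..<k}" if "\<tau> \<in> K \<union> R ` {..<k}" "\<sigma> \<subseteq> \<tau>" for \<sigma> \<tau>
    using that closed[of \<tau> \<sigma>] R(4)[of _ \<sigma>] by (cases "\<sigma> = \<tau>") blast+
  have fin: "finite (R i)" "R i \<noteq> {}" if "i < k" for i
    using R(2)[OF that] card_gt_0_iff[of "R i"] by auto
  \<comment> \<open>All cells have the same size, so none is a face of another, and at each point at
    most one \<open>m i\<close> is nonzero.\<close>
  have R_sub: "i = j" if "i < k" "j < k" "R i \<subseteq> R j" for i j
  proof -
    have "R i = R j"
      using that R(2) fin by (intro card_subset_eq) auto
    with inj that show ?thesis by (auto dest: inj_onD)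
  qed
  define A where "A = {x \<in> topspace X. supp x \<in> K}"
  define m where "m i x = Min (x ` R i)" for i and x :: "'a \<Rightarrow> real"
  have m_le: "m i x \<le> x v" if "i < k" "v \<in> R i" for i x v
    using fin that by (simp add: m_def)
  have m_ge: "0 \<le> m i x" if "i < k" "x \<in> topspace X" for i x
    using fin that by (simp add: m_def X_iff)
  have m0: "m i x = 0 \<longleftrightarrow> \<not> R i \<subseteq> supp x" if "i < k" "x \<in> topspace X" for i x
    unfolding m_def supp_def using that fin by (intro Min_coord_eq_0_iff) (auto simp: X_iff)
  have m0A: "m i x = 0" if "i < k" "x \<in> A" for i x
    using that closed R(3) m0 by (auto simp: A_def)
  have m0R: "m j x = 0" if "i < k" "j < k" "i \<noteq> j" "x \<in> topspace X" "supp x = R i" for i j x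
    using that m0[of j x] R_sub[of j i] by auto
  have cases_X: "x \<in> A \<or> (\<exists>i<k. supp x = R i)" if "x \<in> topspace X" for x
    using that by (auto simp: A_def X_iff)

  \<comment> \<open>Characteristic maps of the attached simplices\<close>
  have "\<exists>f. bij_betw f {..D} (R i)" if "i < k" for i
    using ex_bij_betw_nat_finite[OF fin(1)[OF that]] R(2)[OF that]
    by (simp add: atLeast0LessThan lessThan_Suc_atMost)
  then obtain e where e: "\<And>i. i < k \<Longrightarrow> bij_betw (e i) {..D} (R i)"
    by metis
  have e_img: "e i ` {..D} = R i" if "i < k" for i
    using e[OF that] by (simp add: bij_betw_def)
  define \<phi> where "\<phi> i x = simplex_to_sphere D (\<lambda>j. x (e i j))" for i and x :: "'a \<Rightarrow> real"
  have sum_e: "(\<Sum>j\<le>D. x (e i j)) = 1" if "i < k" "x \<in> topspace X" "supp x \<subseteq> R i" for i x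
  proof -
    have "(\<Sum>j\<le>D. x (e i j)) = sum x (R i)"
      using sum.reindex_bij_betw[OF e[OF that(1)]] .
    also have "\<dots> = sum x V"
      using that R(1) V(1) by (intro sum.mono_neutral_left) (auto simp: supp_def)
    finally show ?thesis using that by (simp add: X_iff)
  qed
  have Min_e: "Min ((\<lambda>j. x (e i j)) ` {..D}) = m i x" if "i < k" for i x
    using e_img[OF that] by (simp add: m_def image_image[of x "e i", symmetric])
  have \<phi>_boundary: "\<phi> i x = b" if "i < k" "x \<in> topspace X" "supp x \<subset> R i" for i x
    unfolding \<phi>_def b_def
  proof (rule simplex_to_sphere_boundary)
    show "Min ((\<lambda>j. x (e i j)) ` {..D}) = 0"
      using that m0[of i x] by (simp add: Min_e)
  qed (use that sum_e in \<open>auto simp: X_iff\<close>)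
  have \<phi>_interior: "\<phi> i x 0 < 1" if "i < k" "x \<in> topspace X" "supp x = R i" for i x
    unfolding \<phi>_def
  proof (rule simplex_to_sphere_interior(1))
    show "0 < Min ((\<lambda>j. x (e i j)) ` {..D})"
      using that m0[of i x] m_ge[of i x] by (simp add: Min_e)
  qed (use that sum_e in \<open>auto simp: X_iff\<close>)
  have \<phi>_inj: "x = y" if "i < k" "x \<in> topspace X" "supp x = R i" "y \<in> topspace X" "supp y = R i"
      "\<phi> i x = \<phi> i y" for i x y
  proof
    fix v
    show "x v = y v"
    proof (cases "v \<in> R i")
      case True
      with e_img[OF that(1)] obtain j where j: "j \<le> D" "v = e i j"
        by auto
      show ?thesis unfolding j(2)
      proof (rule simplex_to_sphere_inj[where y = "\<lambda>j. x (e i j)" and z = "\<lambda>j. y (e i j)"])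
        show "0 < Min ((\<lambda>j. x (e i j)) ` {..D})" "0 < Min ((\<lambda>j. y (e i j)) ` {..D})"
          using that m0[of i] m_ge[of i x] m_ge[of i y] by (simp_all add: Min_e less_le)
      qed (use that sum_e j in \<open>auto simp: X_iff \<phi>_def\<close>)
    next
      case False
      with that have "v \<notin> supp x" "v \<notin> supp y" by auto
      then show ?thesis by (simp add: supp_def)
    qed
  qed

  \<comment> \<open>The quotient map onto the wedge and its fibres\<close>
  define q where "q x = (if supp x \<in> K then None
      else wedge_proj (\<lambda>_. b) (inv_into {..<k} R (supp x), \<phi> (inv_into {..<k} R (supp x)) x))" for x
  have qA: "q x = None" if "x \<in> A" for x
    using that by (simp add: q_def A_def)
  \<comment> \<open>The formula is valid on the whole closed simplex: on the boundary \<phi> takes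
    the value \<open>b\<close>, which \<open>wedge_proj\<close> turns into \<open>None\<close>, the
    value on \<open>A\<close>.\<close>
  have qR: "q x = wedge_proj (\<lambda>_. b) (i, \<phi> i x)" if "i < k" "x \<in> topspace X" "supp x \<subseteq> R i" for i x
  proof (cases "supp x = R i")
    case True
    then show ?thesis
      using that R(3)[of i] inj by (simp add: q_def)
  next
    case False
    then show ?thesis
      using that R(4)[of i "supp x"] \<phi>_boundary[of i x] by (auto simp: q_def wedge_proj_def)
  qed
  have q_interior: "q x = Some (i, \<phi> i x)" if "i < k" "x \<in> topspace X" "supp x = R i" for i x
    using that qR[of i x] \<phi>_interior[OF that] by (auto simp: wedge_proj_def b_def)
  have face: "closedin X {x \<in> topspace X. supp x \<subseteq> \<sigma>}" for \<sigma>
    unfolding X_def supp_def by (rule closedin_geometric_realization_face)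
  have coord: "continuous_map X euclideanreal (\<lambda>x. x v)" for v
    unfolding X_def by (rule continuous_map_geometric_realization_coord)
  have q: "continuous_map X W q"
  \<comment> \<open>A finite closed cover: \<open>None\<close> indexes the cone,
    \<open>Some i\<close> the closed simplex on \<open>R i\<close>.\<close>
  proof (rule pasting_lemma_closed[where I = "insert None (Some ` {..<k})"
        and T = "case_option A (\<lambda>i. {x \<in> topspace X. supp x \<subseteq> R i})"
        and f = "case_option (\<lambda>x. None) (\<lambda>i x. wedge_proj (\<lambda>_. b) (i, \<phi> i x))"])
    have "closedin X (\<Union>\<sigma>\<in>K. {x \<in> topspace X. supp x \<subseteq> \<sigma>})"
      using V face finite_subset[of K "Pow V"] by (intro closedin_Union) auto
    moreover have "(\<Union>\<sigma>\<in>K. {x \<in> topspace X. supp x \<subseteq> \<sigma>}) = A"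
      using closed by (auto simp: A_def)
    ultimately have "closedin X A" by simp
    then show "closedin X (case_option A (\<lambda>i. {x \<in> topspace X. supp x \<subseteq> R i}) j)"
      if "j \<in> insert None (Some ` {..<k})" for j
      using that face by auto
    show "continuous_map (subtopology X (case_option A (\<lambda>i. {x \<in> topspace X. supp x \<subseteq> R i}) j)) W
        (case_option (\<lambda>x. None) (\<lambda>i x. wedge_proj (\<lambda>_. b) (i, \<phi> i x)) j)"
      if "j \<in> insert None (Some ` {..<k})" for j
    proof (cases j)
      case None
      then show ?thesis by (simp add: W_def topspace_wedge)
    next
      case (Some i)
      with that have i: "i < k" by auto
      have "continuous_map (subtopology X {x \<in> topspace X. supp x \<subseteq> R i}) (nsphere D) (\<phi> i)"
        unfolding \<phi>_def
        by (rule continuous_map_simplex_to_sphere)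
          (use sum_e[OF i] in \<open>auto simp: X_iff intro!: continuous_map_from_subtopology coord\<close>)
      then have "continuous_map (subtopology X {x \<in> topspace X. supp x \<subseteq> R i}) W
          ((\<lambda>x. wedge_proj (\<lambda>_. b) (i, x)) \<circ> \<phi> i)"
        unfolding W_def
        by (rule continuous_map_compose[OF _ continuous_map_wedge_inclusion]) (use i in simp)
      with Some show ?thesis by (simp add: o_def)
    qed
    have eq: "case_option (\<lambda>x. None) (\<lambda>i x. wedge_proj (\<lambda>_. b) (i, \<phi> i x)) j x = q x"
      if "j \<in> insert None (Some ` {..<k})" "x \<in> topspace X"
        "x \<in> case_option A (\<lambda>i. {x \<in> topspace X. supp x \<subseteq> R i}) j" for j x
      using that qA qR by (cases j) auto
    then show "case_option (\<lambda>x. None) (\<lambda>i x. wedge_proj (\<lambda>_. b) (i, \<phi> i x)) j x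
        = case_option (\<lambda>x. None) (\<lambda>i x. wedge_proj (\<lambda>_. b) (i, \<phi> i x)) j' x"
      if "j \<in> insert None (Some ` {..<k})" "j' \<in> insert None (Some ` {..<k})"
        "x \<in> topspace X \<inter> case_option A (\<lambda>i. {x \<in> topspace X. supp x \<subseteq> R i}) j
          \<inter> case_option A (\<lambda>i. {x \<in> topspace X. supp x \<subseteq> R i}) j'" for j j' x
      using that eq[of j x] eq[of j' x] by simp
    show "\<exists>j. j \<in> insert None (Some ` {..<k}) \<and> x \<in> case_option A (\<lambda>i. {x \<in> topspace X. supp x \<subseteq> R i}) j
        \<and> q x = case_option (\<lambda>x. None) (\<lambda>i x. wedge_proj (\<lambda>_. b) (i, \<phi> i x)) j x"
      if "x \<in> topspace X" for x
    proof (cases "x \<in> A")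
      case True
      then show ?thesis by (intro exI[of _ None]) (simp add: qA)
    next
      case False
      with cases_X[OF that] obtain i where "i < k" "supp x = R i" by blast
      with that qR[of i x] show ?thesis
        by (intro exI[of _ "Some i"]) simp
    qed
  qed simp

  have apex: "(\<lambda>v. of_bool (v = p)) \<in> A"
  proof -
    have "{p} \<in> K" using cone[OF ne] .
    moreover from this have "p \<in> V" using V by auto
    moreover have "supp (\<lambda>v. of_bool (v = p)) = {p}" by (auto simp: supp_def)
    ultimately show ?thesis
      using V by (simp add: A_def X_iff of_bool_def)
  qed
  have q_surj: "q ` topspace X = topspace W"
  proof
    show "q ` topspace X \<subseteq> topspace W"
      using q by (simp add: continuous_map_image_subset_topspace)
    show "topspace W \<subseteq> q ` topspace X"
    proof
      fix w assume w: "w \<in> topspace W"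
      show "w \<in> q ` topspace X"
      proof (cases w)
        case None
        with apex qA show ?thesis
          by (intro image_eqI[of _ _ "\<lambda>v. of_bool (v = p)"]) (auto simp: A_def)
      next
        case (Some z)
        then obtain i a where wi: "w = Some (i, a)" "i < k" "a \<in> topspace (nsphere D)" "a \<noteq> b"
          using w by (auto simp: W_def topspace_wedge wedge_proj_def split: if_splits)
        obtain y where y: "\<And>j. 0 < y j" "sum y {..D} = 1" "simplex_to_sphere D y = a"
          using simplex_to_sphere_surj[OF wi(3) wi(4)[unfolded b_def]] by blast
        define x where "x v = (if v \<in> R i then y (inv_into {..D} (e i) v) else 0)" for v
        have xe: "x (e i j) = y j" if "j \<le> D" for j
          using that e[OF wi(2)] bij_betw_inv_into_left[OF e[OF wi(2)]] by (auto simp: x_def bij_betw_def)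
        have supp_x: "supp x = R i"
          using y(1) by (auto simp: supp_def x_def less_imp_neq[symmetric])
        have "sum x V = sum x (R i)"
          using R(1)[OF wi(2)] V(1) by (intro sum.mono_neutral_right) (auto simp: x_def)
        also have "\<dots> = (\<Sum>j\<le>D. x (e i j))"
          using sum.reindex_bij_betw[OF e[OF wi(2)], of x] by simp
        also have "\<dots> = 1"
          using y(2) xe by simp
        finally have x: "x \<in> topspace X"
          using y(1) supp_x wi(2) by (auto simp: X_iff x_def less_imp_le)
        have "\<phi> i x = a"
          unfolding \<phi>_def y(3)[symmetric] using xe by (intro simplex_to_sphere_cong)
        then show ?thesis
          using x q_interior[OF wi(2) x supp_x] wi(1) by (intro image_eqI[of _ _ x]) auto
      qed
    qed
  qed
  have q_inj: "x = y \<or> (x \<in> A \<and> y \<in> A)" if "x \<in> topspace X" "y \<in> topspace X" "q x = q y" for x y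
  proof (cases "x \<in> A \<or> y \<in> A")
    case True
    then show ?thesis
      using that cases_X[of x] cases_X[of y] qA q_interior by (metis option.distinct(1))
  next
    case False
    with cases_X[of x] cases_X[of y] that obtain i j
      where ij: "i < k" "supp x = R i" "j < k" "supp y = R j"
      by blast
    then have "(i, \<phi> i x) = (j, \<phi> j y)"
      using that q_interior by (metis option.inject)
    then show ?thesis
      using \<phi>_inj[of i x y] ij that by auto
  qed

  \<comment> \<open>Extending the contraction of the cone over the cells\<close>
  define d where "d = real (Suc D)"
  have "d > 0" by (simp add: d_def)
  \<comment> \<open>The barycentre has coordinates \<open>1 / d\<close>, so expanding from it by
    \<open>1 + t\<close> turns \<open>x v\<close> into \<open>(1 + t) * x v - t / d\<close>. The cap
    \<open>(1 + t) * m i x\<close> stops at the boundary a point that would leave the simplex, and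
    makes the subtraction zero off its interior.\<close>
  define c where "c i t x = min ((1 + t) * m i x) (t / d)" for i t x
  \<comment> \<open>The excess created by the cap: zero while a point stays in its simplex, and
    equal to \<open>t\<close> on the cone.\<close>
  define s where "s t x = t - d * (\<Sum>i<k. c i t x)" for t x
  define z where "z t x v = (1 + t) * x v - (\<Sum>i<k. c i t x * of_bool (v \<in> R i))" for t x v
  \<comment> \<open>As \<open>z\<close> has total mass \<open>1 + s\<close>, dividing by it gives
    the expanded point or, once \<open>s\<close> is positive in a cell, the boundary point crossed;
    this is then joined to the apex with parameter \<open>s\<close>.\<close>
  define h where "h u v = (1 - s (fst u) (snd u)) / (1 + s (fst u) (snd u)) * z (fst u) (snd u) v
      + s (fst u) (snd u) * of_bool (v = p)" for u v
  have cA: "c i t x = 0" if "i < k" "x \<in> A" "t \<in> {0..1}" for i t x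
    using that m0A[of i x] \<open>d > 0\<close> by (simp add: c_def)
  have hA: "h (t, x) v = (1 - t) * x v + t * of_bool (v = p)" if "x \<in> A" "t \<in> {0..1}" for t x v
    using that cA by (simp add: h_def s_def z_def)
  \<comment> \<open>Inside a cell only its own summand survives, so the sums merge the homotopies of
    all cells into one continuous formula.\<close>
  have cR: "(\<Sum>j<k. c j t x) = c i t x" "(\<Sum>j<k. c j t x * of_bool (v \<in> R j)) = c i t x * of_bool (v \<in> R i)"
    if "i < k" "x \<in> topspace X" "supp x = R i" "t \<in> {0..1}" for i t x v
  proof -
    have zero: "c j t x = 0" if "j < k" "j \<noteq> i" for j
      using that m0R[of i j x] \<open>i < k\<close> \<open>x \<in> topspace X\<close> \<open>supp x = R i\<close> \<open>t \<in> {0..1}\<close> \<open>d > 0\<close>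
      by (simp add: c_def)
    have only: "(\<Sum>j<k. f j) = f i" if "\<And>j. j < k \<Longrightarrow> j \<noteq> i \<Longrightarrow> f j = 0" for f :: "nat \<Rightarrow> real"
      using that \<open>i < k\<close> by (simp add: sum.remove[of "{..<k}" i])
    show "(\<Sum>j<k. c j t x) = c i t x"
        "(\<Sum>j<k. c j t x * of_bool (v \<in> R j)) = c i t x * of_bool (v \<in> R i)"
      by (rule only, simp add: zero)+
  qed
  have c_ge: "0 \<le> c i t x" if "i < k" "x \<in> topspace X" "t \<in> {0..1}" for i t x
    using that m_ge[of i x] \<open>d > 0\<close> by (simp add: c_def)
  have s: "0 \<le> s t x \<and> s t x \<le> 1" if "x \<in> topspace X" "t \<in> {0..1}" for t x
  proof (cases "x \<in> A")
    case True
    with that cA show ?thesis by (simp add: s_def)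
  next
    case False
    with cases_X[OF that(1)] obtain i where i: "i < k" "supp x = R i" by blast
    have "d * c i t x \<le> d * (t / d)"
      using \<open>d > 0\<close> by (intro mult_left_mono) (auto simp: c_def)
    then show ?thesis
      using that i c_ge[OF i(1) that] \<open>d > 0\<close> cR(1)[OF i(1) that(1) i(2) that(2)]
      by (simp add: s_def) (smt (verit) mult_nonneg_nonneg)
  qed
  have z_ge: "0 \<le> z t x v" if "x \<in> topspace X" "t \<in> {0..1}" for t x v
  proof (cases "x \<in> A")
    case True
    with that cA show ?thesis by (simp add: z_def X_iff)
  next
    case False
    with cases_X[OF that(1)] obtain i where i: "i < k" "supp x = R i" by blast
    have "c i t x \<le> (1 + t) * x v" if "v \<in> R i"
    proof -
      have "c i t x \<le> (1 + t) * m i x" by (simp add: c_def)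
      also have "\<dots> \<le> (1 + t) * x v"
        using m_le[OF i(1) that] \<open>t \<in> {0..1}\<close> by (intro mult_left_mono) auto
      finally show ?thesis .
    qed
    then show ?thesis
      using that unfolding z_def cR(2)[OF i(1) that(1) i(2) that(2)] by (cases "v \<in> R i") (auto simp: X_iff)
  qed
  have sum_z: "sum (z t x) V = 1 + s t x" if "x \<in> topspace X" for t x
  proof -
    have "(\<Sum>v\<in>V. c i t x * of_bool (v \<in> R i)) = d * c i t x" if "i < k" for i
    proof -
      have "(\<Sum>v\<in>V. c i t x * of_bool (v \<in> R i)) = c i t x * (\<Sum>v\<in>V. of_bool (v \<in> R i))"
        by (simp add: sum_distrib_left)
      also have "(\<Sum>v\<in>V. of_bool (v \<in> R i)) = real (card (R i))"
        using V(1) R(1)[OF that] by (simp add: of_bool_def sum.If_cases Int_absorb1)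
      finally show ?thesis using R(2)[OF that] by (simp add: d_def)
    qed
    then have "(\<Sum>v\<in>V. \<Sum>i<k. c i t x * of_bool (v \<in> R i)) = d * (\<Sum>i<k. c i t x)"
      by (subst sum.swap) (simp add: sum_distrib_left)
    moreover have "(\<Sum>v\<in>V. (1 + t) * x v) = 1 + t"
      using that by (simp add: X_iff flip: sum_distrib_left)
    ultimately show ?thesis
      by (simp add: z_def s_def sum_subtractf)
  qed
  have hX: "h (t, x) \<in> topspace X" if "x \<in> topspace X" "t \<in> {0..1}" for t x
    unfolding X_iff
  proof (intro conjI allI)
    show "0 \<le> h (t, x) v" for v
      using s[OF that] z_ge[OF that] by (simp add: h_def)
    have "p \<in> V" using cone[OF ne] V by auto
    have "sum (h (t, x)) V = (1 - s t x) / (1 + s t x) * sum (z t x) V + s t x * (\<Sum>v\<in>V. of_bool (v = p))"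
      by (simp add: h_def sum.distrib sum_distrib_left)
    also have "(\<Sum>v\<in>V. of_bool (v = p)) = (1::real)"
      using V(1) \<open>p \<in> V\<close> by (simp add: of_bool_def)
    finally show "sum (h (t, x)) V = 1"
      using s[OF that] unfolding sum_z[OF that(1)] by simp
    show "supp (h (t, x)) \<in> K \<union> R ` {..<k}"
    proof (cases "x \<in> A")
      case True
      then have "supp (h (t, x)) \<subseteq> insert p (supp x)"
        using that hA by (auto simp: supp_def)
      with True cone closed show ?thesis by (auto simp: A_def)
    next
      case False
      with cases_X[OF that(1)] obtain i where i: "i < k" "supp x = R i" by blast
      have z: "z t x v = (1 + t) * x v - c i t x * of_bool (v \<in> R i)" for v
        unfolding z_def cR(2)[OF i(1) that(1) i(2) that(2)] ..
      have supp_z: "supp (z t x) \<subseteq> R i"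
        using i(2) by (auto simp: supp_def z)
      show ?thesis
      proof (cases "s t x = 0")
        case True
        then have "supp (h (t, x)) = supp (z t x)"
          by (simp add: supp_def h_def)
        with supp_z closed'[of "R i"] i show ?thesis by auto
      next
        case False
        \<comment> \<open>The cap is active: a minimal coordinate becomes zero, the support of
          \<open>z\<close> shrinks to a proper face of \<open>R i\<close>, and this lies in
          \<open>K\<close>, where joining with \<open>p\<close> is allowed.\<close>
        then have "c i t x \<noteq> t / d"
          using cR(1)[OF i(1) that(1) i(2) that(2)] \<open>d > 0\<close> by (auto simp: s_def)
        then have c: "c i t x = (1 + t) * m i x"
          by (auto simp: c_def min_def split: if_splits)
        obtain v where v: "v \<in> R i" "x v = m i x"
          using Min_image_attained[OF fin[OF i(1)]] unfolding m_def by metis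
        then have "z t x v = 0" by (simp add: z c)
        with v supp_z have "supp (z t x) \<subset> R i" by (auto simp: supp_def)
        then have "insert p (supp (z t x)) \<in> K"
          using R(4)[OF i(1)] cone by blast
        moreover have "supp (h (t, x)) \<subseteq> insert p (supp (z t x))"
          by (auto simp: supp_def h_def)
        ultimately show ?thesis using closed by blast
      qed
    qed
  qed
  have cfst: "continuous_map (prod_topology ?I X) euclideanreal fst"
    by (rule continuous_map_into_fulltopology[OF continuous_map_fst])
  have csnd: "continuous_map (prod_topology ?I X) euclideanreal (\<lambda>u. snd u v)" for v
    using continuous_map_compose[OF continuous_map_snd coord] by (simp add: o_def)
  have c_cont: "continuous_map (prod_topology ?I X) euclideanreal (\<lambda>u. c i (fst u) (snd u))" if "i < k" for i
    unfolding c_def m_def using fin[OF that] \<open>d > 0\<close>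
    by (intro continuous_intros continuous_map_real_Min cfst csnd) auto
  have s_cont: "continuous_map (prod_topology ?I X) euclideanreal (\<lambda>u. s (fst u) (snd u))"
    unfolding s_def by (intro continuous_intros cfst c_cont) auto
  have z_cont: "continuous_map (prod_topology ?I X) euclideanreal (\<lambda>u. z (fst u) (snd u) v)" for v
    unfolding z_def by (intro continuous_intros cfst csnd c_cont) auto
  have h_cont: "continuous_map (prod_topology ?I X) X h"
    unfolding X_def
  proof (rule continuous_map_into_geometric_realization, fold X_def)
    have "1 + s (fst u) (snd u) \<noteq> 0" if "u \<in> topspace (prod_topology ?I X)" for u
      using that s[of "snd u" "fst u"] by auto
    then show "continuous_map (prod_topology ?I X) euclideanreal (\<lambda>u. h u v)" for v
      unfolding h_def by (intro continuous_intros s_cont z_cont) auto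
    show "h u \<in> topspace X" if "u \<in> topspace (prod_topology ?I X)" for u
      using that hX by auto
  qed

  have "X homotopy_equivalent_space W"
  proof (rule homotopy_equivalent_space_collapse_contractible[OF _ _ q q_surj h_cont])
    show "compact_space X"
      unfolding X_def by (rule compact_space_geometric_realization[OF V(1) V' closed'])
    have "b \<in> topspace (nsphere D)"
      by (simp add: nsphere b_def power2_eq_square if_distrib[of "\<lambda>x. x * _"] cong: if_cong)
    then show "Hausdorff_space W"
      unfolding W_def by (intro Hausdorff_space_wedge Hausdorff_space_nsphere)
    show "h (0, x) = x" if "x \<in> topspace X" for x
    proof -
      have "c i 0 x = 0" if "i < k" for i
        using m_ge[OF that \<open>x \<in> topspace X\<close>] by (simp add: c_def)
      then show ?thesis by (simp add: fun_eq_iff h_def s_def z_def)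
    qed
    show "h (t, x) \<in> A" if "t \<in> {0..1}" "x \<in> A" for t x
    proof -
      have "supp (h (t, x)) \<subseteq> insert p (supp x)"
        using that hA by (auto simp: supp_def)
      then show ?thesis
        using that hX[of x t] cone closed by (auto simp: A_def)
    qed
    show "h (1, x) = (\<lambda>v. of_bool (v = p))" if "x \<in> A" for x
      using hA[OF that] by (simp add: fun_eq_iff)
  qed (use qA q_inj in auto)
  then show ?thesis
    by (simp add: X_def W_def wedge_of_spheres_def b_def)
qed


section \<open>Total 2-cut complexes of triangle-free graphs\<close>

lemma in_total_2_cut_complex_iff:
  "\<sigma> \<in> total_2_cut_complex G \<longleftrightarrow>
    \<sigma> \<subseteq> verts G \<and> (\<exists>a\<in>verts G - \<sigma>. \<exists>b\<in>verts G - \<sigma>. a \<noteq> b \<and> {a, b} \<notin> edges G)"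
proof -
  have "\<sigma> \<in> total_2_cut_complex G \<longleftrightarrow>
      (\<exists>a b. a \<in> verts G \<and> b \<in> verts G \<and> a \<noteq> b \<and> {a, b} \<notin> edges G \<and> \<sigma> \<subseteq> verts G - {a, b})"
    unfolding total_2_cut_complex_def complex_generated_by_def mem_Collect_eq Bex_def by metis
  then show ?thesis
    unfolding subset_Diff_insert by auto
qed

text \<open>\<open>par\<close> encodes the spanning tree, rooted at \<open>p\<close>. The collapses are made in the order of
  increasing \<open>rank\<close>: the complement of \<open>{p, v, par v}\<close> becomes a free face of the complement of
  \<open>{p, v}\<close> once the complement of \<open>{p, par v}\<close> is gone.\<close>

lemma homotopy_equivalent_total_2_cut_complex:
  fixes G :: "'a ugraph" and rank :: "'a \<Rightarrow> nat"
  assumes fin: "finite (verts G)" and p: "p \<in> verts G" and card: "card (verts G) = D + 4"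
    and edges: "\<And>e. e \<in> edges G \<Longrightarrow> \<exists>a\<in>verts G. \<exists>b\<in>verts G. e = {a, b} \<and> a \<noteq> b"
    and triangle_free: "\<And>a b c. {a, b} \<in> edges G \<Longrightarrow> {b, c} \<in> edges G \<Longrightarrow> {a, c} \<notin> edges G"
    and rank: "inj_on rank (verts G)"
    and par: "\<And>v. v \<in> verts G - {p} \<Longrightarrow> par v \<in> verts G" "\<And>v. v \<in> verts G - {p} \<Longrightarrow> {v, par v} \<in> edges G"
      "\<And>v. v \<in> verts G - {p} \<Longrightarrow> rank (par v) < rank v" "\<And>v. {p, v} \<in> edges G \<Longrightarrow> par v = p"
  shows "geometric_realization (total_2_cut_complex G) homotopy_equivalent_space
    wedge_of_spheres (card (edges G - (\<lambda>v. {v, par v}) ` (verts G - {p}))) D"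
proof -
  define V where "V = verts G"
  define \<Delta> where "\<Delta> = total_2_cut_complex G"
  define E where "E = edges G - (\<lambda>v. {v, par v}) ` (V - {p})"
  define A where "A = {v \<in> V - {p}. {p, v} \<notin> edges G}"
  define F where "F v = V - {p, v}" for v
  define T where "T v = V - {p, v, par v}" for v
  define R where "R e = V - insert p e" for e
  define star where "star = {\<sigma> \<in> \<Delta>. insert p \<sigma> \<in> \<Delta>}"
  define L where "L j = \<Delta> - (\<Union>v\<in>{v \<in> A. rank v < j}. {F v, T v})" for j
  have pV: "p \<in> V" using p by (simp add: V_def)
  have \<Delta>_iff: "\<sigma> \<in> \<Delta> \<longleftrightarrow> \<sigma> \<subseteq> V \<and> (\<exists>a\<in>V - \<sigma>. \<exists>b\<in>V - \<sigma>. a \<noteq> b \<and> {a, b} \<notin> edges G)" for \<sigma>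
    unfolding \<Delta>_def V_def by (rule in_total_2_cut_complex_iff)
  have \<Delta>_sub: "\<Delta> \<subseteq> Pow V" by (auto simp: \<Delta>_iff)
  have \<Delta>_closed: "\<sigma> \<in> \<Delta>" if "\<tau> \<in> \<Delta>" "\<sigma> \<subseteq> \<tau>" for \<sigma> \<tau>
    using that unfolding \<Delta>_iff by blast
  have three: "\<sigma> \<in> \<Delta>" if "\<sigma> \<subseteq> V" "{a, b, c} \<subseteq> V - \<sigma>" "a \<noteq> b" "b \<noteq> c" "a \<noteq> c" for \<sigma> a b c
    using that triangle_free[of a b c] unfolding \<Delta>_iff by blast
  have A: "v \<in> V" "v \<noteq> p" "{p, v} \<notin> edges G" "par v \<in> V" "par v \<noteq> p" "par v \<noteq> v" "{v, par v} \<in> edges G"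
      "rank (par v) < rank v" if "v \<in> A" for v
  proof -
    show v: "v \<in> V" "v \<noteq> p" "{p, v} \<notin> edges G" using that by (auto simp: A_def)
    show "par v \<in> V" "{v, par v} \<in> edges G" "rank (par v) < rank v"
      using par(1-3)[of v] v by (auto simp: V_def)
    then show "par v \<noteq> p" "par v \<noteq> v"
      using v by (auto simp: insert_commute)
  qed
  have E_edge: "\<exists>a b. e = {a, b} \<and> a \<noteq> b \<and> a \<in> V - {p} \<and> b \<in> V - {p}" if "e \<in> E" for e
  proof -
    from that have "e \<in> edges G" by (simp add: E_def)
    then obtain a b where ab: "e = {a, b}" "a \<noteq> b" "a \<in> V" "b \<in> V"
      using edges[of e] unfolding V_def by blast
    \<comment> \<open>Every edge at \<open>p\<close> is a tree edge by \<open>par(4)\<close>, so the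
      edges in \<open>E\<close> avoid \<open>p\<close>.\<close>
    have notE: "{v, p} \<notin> E" if "v \<in> V" "v \<noteq> p" for v
    proof
      assume "{v, p} \<in> E"
      then have "{p, v} \<in> edges G" by (simp add: E_def insert_commute)
      then have "{v, p} = {v, par v}" using par(4) by simp
      with that \<open>{v, p} \<in> E\<close> show False by (auto simp: E_def)
    qed
    have "a \<noteq> p" "b \<noteq> p"
      using notE[of a] notE[of b] ab \<open>e \<in> E\<close> by (auto simp: insert_commute)
    with ab show ?thesis by blast
  qed

  \<comment> \<open>The collapses, one rank at a time\<close>
  have collapse: "geometric_realization (L j) homotopy_equivalent_space geometric_realization (L (Suc j))" for j
  proof (cases "\<exists>v\<in>A. rank v = j")
    case False
    then have "{v \<in> A. rank v < Suc j} = {v \<in> A. rank v < j}"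
      by (auto simp: less_Suc_eq)
    then show ?thesis by (simp add: L_def homotopy_equivalent_space_refl)
  next
    case True
    then obtain v where v: "v \<in> A" "rank v = j" by blast
    let ?w = "par v"
    have "u = v" if "u \<in> A" "rank u = j" for u
      using inj_onD[OF rank, of u v] v that A(1)[of u] A(1)[of v] by (simp add: V_def)
    then have "rank u < Suc j \<longleftrightarrow> u = v \<or> rank u < j" if "u \<in> A" for u
      using that v(2) by (auto simp: less_Suc_eq)
    with v(1) have "{u \<in> A. rank u < Suc j} = insert v {u \<in> A. rank u < j}"
      by blast
    then have L_Suc: "L (Suc j) = L j - {T v, F v}"
      by (auto simp: L_def)
    have ins: "insert ?w (T v) = F v"
      using A[OF v(1)] by (auto simp: T_def F_def)
    \<comment> \<open>The set \<rho> misses \<open>v\<close>, whereas every \<open>F u\<close> and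
      \<open>T u\<close> removed earlier contains it, since \<open>u\<close> and
      \<open>par u\<close> have rank below \<open>j\<close>.\<close>
    have kept: "\<rho> \<in> L j" if "\<rho> \<in> \<Delta>" "\<rho> \<subseteq> F v" for \<rho>
    proof -
      have "\<rho> \<noteq> F u" "\<rho> \<noteq> T u" if "u \<in> A" "rank u < j" for u
        using A[OF that(1)] A(1,2)[OF v(1)] v(2) that(2) \<open>\<rho> \<subseteq> F v\<close> by (auto simp: F_def T_def)
      with \<open>\<rho> \<in> \<Delta>\<close> show ?thesis by (auto simp: L_def)
    qed
    have sub_F: "\<rho> \<in> L j" if "\<rho> \<subseteq> F v" for \<rho>
    proof (rule kept[OF _ that])
      have "\<rho> \<subseteq> V" "p \<in> V - \<rho>" "v \<in> V - \<rho>"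
        using that pV A(1)[OF v(1)] by (auto simp: F_def)
      with A(2,3)[OF v(1)] show "\<rho> \<in> \<Delta>"
        unfolding \<Delta>_iff by metis
    qed
    have "geometric_realization (L j) homotopy_equivalent_space
        geometric_realization (L j - {T v, insert ?w (T v)})"
    proof (rule homotopy_equivalent_elementary_collapse)
      show "finite V" using fin by (simp add: V_def)
      show "L j \<subseteq> Pow V" using \<Delta>_sub by (auto simp: L_def)
      have "card (T v) = D + 1"
        using fin card A[OF v(1)] p unfolding T_def V_def by (subst card_Diff_subset) auto
      then show "T v \<noteq> {}" by auto
      show "?w \<notin> T v" by (simp add: T_def)
      show "T v \<in> L j" "insert ?w (T v) \<in> L j"
        using sub_F[of "T v"] sub_F[of "F v"] ins by auto
      show "\<rho> \<in> L j" if "\<rho> \<subseteq> insert ?w (T v)" for \<rho>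
        using that sub_F ins by simp
      \<comment> \<open>The complement of \<rho> lies in \<open>{p, v, ?w}\<close> and contains a
        non-adjacent pair. As \<open>{v, ?w}\<close> is an edge, the pair contains \<open>p\<close>.
        If \<rho> contains \<open>v\<close>, the pair is \<open>{p, ?w}\<close> and \<rho> is
        \<open>F ?w\<close>, already removed because \<open>?w\<close> is in \<open>A\<close> with
        smaller rank.\<close>
      show "\<rho> = T v \<or> \<rho> = insert ?w (T v)" if \<rho>: "\<rho> \<in> L j" "T v \<subseteq> \<rho>" for \<rho>
      proof -
        have "\<rho> \<in> \<Delta>" using \<rho> by (simp add: L_def)
        then obtain a b where ab: "a \<in> V - \<rho>" "b \<in> V - \<rho>" "a \<noteq> b" "{a, b} \<notin> edges G" and "\<rho> \<subseteq> V"
          unfolding \<Delta>_iff by blast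
        have "a \<in> {p, v, ?w}" "b \<in> {p, v, ?w}"
          using ab \<rho>(2) by (auto simp: T_def)
        then have "{a, b} = {p, v} \<or> {a, b} = {p, ?w}"
          using ab A(7)[OF v(1)] by (auto simp: insert_commute)
        then consider "p \<notin> \<rho>" "v \<notin> \<rho>" | "p \<notin> \<rho>" "v \<in> \<rho>" "?w \<notin> \<rho>" "{p, ?w} \<notin> edges G"
          using ab by (cases "v \<in> \<rho>") (auto simp: doubleton_eq_iff insert_commute)
        then show ?thesis
        proof cases
          case 1
          then show ?thesis
            unfolding ins using \<rho>(2) \<open>\<rho> \<subseteq> V\<close> by (cases "?w \<in> \<rho>") (auto simp: T_def F_def)
        next
          case 2
          then have "\<rho> = F ?w"
            using \<rho>(2) \<open>\<rho> \<subseteq> V\<close> by (auto simp: T_def F_def)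
          moreover have "?w \<in> A" "rank ?w < j"
            using 2 A[OF v(1)] v(2) by (auto simp: A_def)
          ultimately show ?thesis
            using \<rho>(1) by (auto simp: L_def)
        qed
      qed
    qed
    then show ?thesis by (simp add: L_Suc ins)
  qed
  have L0: "geometric_realization \<Delta> homotopy_equivalent_space geometric_realization (L j)" for j
  proof (induction j)
    case 0
    then show ?case by (simp add: L_def homotopy_equivalent_space_refl)
  next
    case (Suc j)
    then show ?case
      using collapse homotopy_eqv_trans by blast
  qed

  \<comment> \<open>The complex that remains: star and non-tree cells\<close>
  define N where "N = Suc (Max (rank ` V))"
  have "rank v < N" if "v \<in> A" for v
    using that A(1) fin by (auto simp: N_def V_def less_Suc_eq_le)
  then have L_N: "L N = \<Delta> - (\<Union>v\<in>A. {F v, T v})"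
    by (auto simp: L_def)
  have L_eq: "L N = star \<union> R ` E"
  proof (intro equalityI subsetI)
    fix \<sigma> assume "\<sigma> \<in> star \<union> R ` E"
    then show "\<sigma> \<in> L N"
    proof
      assume \<sigma>: "\<sigma> \<in> star"
      have "\<sigma> \<noteq> F v" "\<sigma> \<noteq> T v" if "v \<in> A" for v
      proof -
        \<comment> \<open>Adding \<open>p\<close> leaves the complement \<open>{v}\<close> or
          \<open>{v, par v}\<close>, both cliques, so no removed face lies in the star.\<close>
        have "insert p (F v) \<notin> \<Delta>"
          using A[OF that] by (auto simp: \<Delta>_iff F_def)
        then show "\<sigma> \<noteq> F v" using \<sigma> by (auto simp: star_def)
        have "insert p (T v) \<notin> \<Delta>"
          using A[OF that] by (auto simp: \<Delta>_iff T_def insert_commute)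
        then show "\<sigma> \<noteq> T v" using \<sigma> by (auto simp: star_def)
      qed
      with \<sigma> show ?thesis by (auto simp: L_N star_def)
    next
      assume "\<sigma> \<in> R ` E"
      then obtain a b where ab: "\<sigma> = V - {p, a, b}" "{a, b} \<in> E" "a \<noteq> b" "a \<in> V - {p}" "b \<in> V - {p}"
        using E_edge by (fastforce simp: R_def)
      have "\<sigma> \<in> \<Delta>"
        using ab pV by (intro three[of _ p a b]) auto
      moreover have "\<sigma> \<noteq> F v" "\<sigma> \<noteq> T v" if "v \<in> A" for v
      proof -
        have compl: "V - \<sigma> - {p} = {a, b}"
          unfolding ab(1) using ab(4,5) by auto
        have F_compl: "V - F v - {p} = {v}" and T_compl: "V - T v - {p} = {v, par v}"
          using A[OF that] by (auto simp: F_def T_def)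
        have "{v, par v} \<notin> E"
          using A[OF that] by (auto simp: E_def)
        then show "\<sigma> \<noteq> T v"
          using compl T_compl ab(2) by metis
        have "{a, b} \<noteq> {v}"
          using ab(3) by auto
        then show "\<sigma> \<noteq> F v"
          using compl F_compl by metis
      qed
      ultimately show ?thesis by (auto simp: L_N)
    qed
  next
    fix \<sigma> assume \<sigma>: "\<sigma> \<in> L N"
    show "\<sigma> \<in> star \<union> R ` E"
    proof (cases "insert p \<sigma> \<in> \<Delta>")
      case True
      with \<sigma> show ?thesis by (simp add: star_def L_N)
    next
      case False
      from \<sigma> have "\<sigma> \<in> \<Delta>" and \<sigma>_ne: "\<And>v. v \<in> A \<Longrightarrow> \<sigma> \<noteq> F v \<and> \<sigma> \<noteq> T v"
        by (auto simp: L_N)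
      then have "\<sigma> \<subseteq> V" by (simp add: \<Delta>_iff)
      have clique: "{a, b} \<in> edges G" if "a \<in> V - insert p \<sigma>" "b \<in> V - insert p \<sigma>" "a \<noteq> b" for a b
        using False that pV \<open>\<sigma> \<subseteq> V\<close> unfolding \<Delta>_iff by blast
      obtain a b where ab: "a \<in> V - \<sigma>" "b \<in> V - \<sigma>" "a \<noteq> b" "{a, b} \<notin> edges G"
        using \<open>\<sigma> \<in> \<Delta>\<close> unfolding \<Delta>_iff by blast
      then have "a = p \<or> b = p" using clique by blast
      then have "p \<notin> \<sigma>" using ab by auto
      have "\<exists>c. c \<in> V - insert p \<sigma> \<and> {p, c} \<notin> edges G"
      proof (cases "a = p")
        case True
        with ab show ?thesis by blast
      next
        case False
        with \<open>a = p \<or> b = p\<close> ab show ?thesis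
          by (intro exI[of _ a]) (auto simp: insert_commute)
      qed
      then obtain c where c: "c \<in> V - insert p \<sigma>" "{p, c} \<notin> edges G" by blast
      then have "c \<in> A" by (auto simp: A_def)
      have "V - insert p \<sigma> \<noteq> {c}"
      proof
        assume "V - insert p \<sigma> = {c}"
        then have "\<sigma> = F c" using \<open>\<sigma> \<subseteq> V\<close> \<open>p \<notin> \<sigma>\<close> c(1) by (auto simp: F_def)
        with \<sigma>_ne \<open>c \<in> A\<close> show False by blast
      qed
      with c obtain c' where c': "c' \<in> V - insert p \<sigma>" "c' \<noteq> c" by blast
      \<comment> \<open>The vertices outside \<open>insert p \<sigma>\<close> form a clique, so by
        triangle-freeness there are at most two.\<close>
      have "x \<in> {c, c'}" if "x \<in> V - insert p \<sigma>" for x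
        using that c c' clique[of c c'] clique[of c' x] clique[of c x] triangle_free[of c c' x] by blast
      then have \<sigma>_eq: "\<sigma> = V - {p, c, c'}"
        using \<open>\<sigma> \<subseteq> V\<close> \<open>p \<notin> \<sigma>\<close> c(1) c'(1) by auto
      \<comment> \<open>A tree edge avoiding \<open>p\<close> has its child end \<open>v\<close> in
        \<open>A\<close>, and then \<sigma> would be the removed face \<open>T v\<close>.\<close>
      have "{c, c'} \<noteq> {v, par v}" if v: "v \<in> V - {p}" for v
      proof
        assume eq: "{c, c'} = {v, par v}"
        then have "par v \<noteq> p" using c(1) c'(1) by (auto simp: doubleton_eq_iff)
        then have "v \<in> A" using v par(4)[of v] by (auto simp: A_def)
        moreover have "\<sigma> = T v" unfolding \<sigma>_eq T_def eq ..
        ultimately show False using \<sigma>_ne by blast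
      qed
      then have "{c, c'} \<in> E"
        using clique[OF c(1) c'(1)] c' by (auto simp: E_def)
      moreover have "\<sigma> = R {c, c'}" by (simp add: \<sigma>_eq R_def)
      ultimately show ?thesis by blast
    qed
  qed

  \<comment> \<open>Attaching the surviving simplices to the star of \<open>p\<close>\<close>
  have "finite E"
  proof (rule finite_subset)
    show "E \<subseteq> Pow V" using E_edge by fastforce
  qed (use fin in \<open>simp add: V_def\<close>)
  then obtain f where f: "bij_betw f {..<card E} E"
    using ex_bij_betw_nat_finite[of E] unfolding atLeast0LessThan by blast
  have fE: "f i \<in> E" if "i < card E" for i
    using f that by (auto simp: bij_betw_def)
  have R_inj: "inj_on R E"
  proof (rule inj_on_inverseI)
    fix e assume "e \<in> E"
    with E_edge[OF this] show "V - insert p (R e) = e"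
      by (auto simp: R_def)
  qed
  have "geometric_realization (star \<union> (R \<circ> f) ` {..<card E}) homotopy_equivalent_space
      wedge_of_spheres (card E) D"
  proof (rule homotopy_equivalent_cone_with_cells)
    show "finite V" using fin by (simp add: V_def)
    show "star \<subseteq> Pow V" using \<Delta>_sub by (auto simp: star_def)
    show "\<sigma> \<in> star" if "\<tau> \<in> star" "\<sigma> \<subseteq> \<tau>" for \<sigma> \<tau>
      using that \<Delta>_closed[of \<tau> \<sigma>] \<Delta>_closed[of "insert p \<tau>" "insert p \<sigma>"] by (auto simp: star_def)
    \<comment> \<open>Four vertices suffice for \<open>{p}\<close> to be a face, which makes the
      star a nonempty cone.\<close>
    have "3 \<le> card (V - {p})"
      using card p fin by (simp add: V_def)
    then obtain B where "B \<subseteq> V - {p}" "card B = 3"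
      by (meson obtain_subset_with_card_n)
    then obtain a b c where "{a, b, c} \<subseteq> V - {p}" "a \<noteq> b" "b \<noteq> c" "a \<noteq> c"
      by (auto simp: card_3_iff)
    then have "{p} \<in> \<Delta>"
      using pV by (intro three[of _ a b c]) auto
    with \<Delta>_closed[of "{p}" "{}"] show "{} \<in> star" by (simp add: star_def)
    show "insert p \<sigma> \<in> star" if "\<sigma> \<in> star" for \<sigma>
      using that by (simp add: star_def)
    show "inj_on (R \<circ> f) {..<card E}"
      using f R_inj by (intro comp_inj_on) (auto simp: bij_betw_def)
    fix i assume "i < card E"
    then have "f i \<in> E" by (rule fE)
    then obtain a b where ab: "f i = {a, b}" "a \<noteq> b" "a \<in> V - {p}" "b \<in> V - {p}"
      using E_edge by blast
    have Ri: "(R \<circ> f) i = V - {p, a, b}" by (simp add: R_def ab)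
    show "(R \<circ> f) i \<subseteq> V" unfolding Ri by blast
    have "card (V - {p, a, b}) = card V - card {p, a, b}"
      using ab pV by (intro card_Diff_subset) auto
    moreover have "card {p, a, b} = 3" using ab by auto
    ultimately show "card ((R \<circ> f) i) = Suc D"
      unfolding Ri using card by (simp add: V_def)
    have "insert p (V - {p, a, b}) = V - {a, b}"
      using pV ab by auto
    moreover have "V - {a, b} \<notin> \<Delta>"
      using \<open>f i \<in> E\<close> ab by (auto simp: \<Delta>_iff E_def insert_commute)
    ultimately show "(R \<circ> f) i \<notin> star" unfolding Ri by (simp add: star_def)
    show "\<sigma> \<in> star" if "\<sigma> \<subset> (R \<circ> f) i" for \<sigma>
    proof -
      from that obtain x where x: "x \<in> V - {p, a, b}" "x \<notin> \<sigma>" and "\<sigma> \<subseteq> V - {p, a, b}"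
        unfolding Ri by blast
      \<comment> \<open>A proper subset misses a further vertex \<open>x\<close>; the three vertices
        \<open>a\<close>, \<open>b\<close>, \<open>x\<close> remain outside after \<open>p\<close>
        is added.\<close>
      then have "insert p \<sigma> \<in> \<Delta>"
        using ab pV by (intro three[of _ a b x]) auto
      then show ?thesis
        using \<Delta>_closed[of "insert p \<sigma>" \<sigma>] by (auto simp: star_def)
    qed
  qed
  moreover have "(R \<circ> f) ` {..<card E} = R ` E"
    using f by (simp only: image_comp[symmetric] bij_betw_imp_surj_on)
  ultimately have "geometric_realization (L N) homotopy_equivalent_space wedge_of_spheres (card E) D"
    by (simp add: L_eq)
  with L0[of N] show ?thesis
    unfolding \<Delta>_def E_def V_def by (rule homotopy_eqv_trans)
qed


section \<open>Grid graphs\<close>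

lemma complex_dim_total_2_cut_complex:
  assumes fin: "finite (verts G)"
    and ab: "a \<in> verts G" "b \<in> verts G" "a \<noteq> b" "{a, b} \<notin> edges G"
  shows "complex_dim (total_2_cut_complex G) = int (card (verts G)) - 3"
proof -
  have card2: "card (verts G - {c, d}) = card (verts G) - 2"
    if "c \<in> verts G" "d \<in> verts G" "c \<noteq> d" for c d
    using that by (simp add: card_Diff_subset)
  have "Max (card ` total_2_cut_complex G) = card (verts G) - 2"
  proof (rule Max_eqI)
    have "total_2_cut_complex G \<subseteq> Pow (verts G)"
      by (auto simp: in_total_2_cut_complex_iff)
    then show "finite (card ` total_2_cut_complex G)"
      using fin by (meson finite_Pow_iff finite_imageI finite_subset)
    have "verts G - {a, b} \<in> total_2_cut_complex G"
      using ab by (auto simp: in_total_2_cut_complex_iff)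
    then show "card (verts G) - 2 \<in> card ` total_2_cut_complex G"
      using card2[OF ab(1-3)] by (metis image_eqI)
    fix k assume "k \<in> card ` total_2_cut_complex G"
    then obtain \<sigma> c d where "k = card \<sigma>" "\<sigma> \<subseteq> verts G" "c \<in> verts G - \<sigma>" "d \<in> verts G - \<sigma>" "c \<noteq> d"
      by (auto simp: in_total_2_cut_complex_iff)
    moreover from this have "\<sigma> \<subseteq> verts G - {c, d}" by blast
    ultimately show "k \<le> card (verts G) - 2"
      using fin card2[of c d] card_mono[of "verts G - {c, d}" \<sigma>] by simp
  qed
  moreover have "2 \<le> card (verts G)"
    using card_mono[OF fin, of "{a, b}"] ab by simp
  ultimately show ?thesis
    by (simp add: complex_dim_def)
qed

lemma verts_grid_graph: "verts (grid_graph m n) = {..<m} \<times> {..<n}"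
  by (simp add: grid_graph_def cartesian_product_def path_graph_def)

lemma edges_grid_graph:
  "edges (grid_graph m n) =
    {{(i, j), (Suc i, j)} | i j. Suc i < m \<and> j < n} \<union> {{(i, j), (i, Suc j)} | i j. i < m \<and> Suc j < n}"
  (is "_ = ?v \<union> ?h")
proof -
  have path: "{u, u'} \<in> edges (path_graph k) \<longleftrightarrow> (u' = Suc u \<and> Suc u < k) \<or> (u = Suc u' \<and> Suc u' < k)"
    for u u' k
    by (auto simp: path_graph_def doubleton_eq_iff)
  have "{{(u, w), (u', w)} | u u' w. {u, u'} \<in> edges (path_graph m) \<and> w \<in> verts (path_graph n)} = ?v"
    unfolding path by (auto simp: path_graph_def)
  moreover have "{{(u, w), (u, w')} | u w w'. u \<in> verts (path_graph m) \<and> {w, w'} \<in> edges (path_graph n)} = ?h"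
    unfolding path by (auto simp: path_graph_def)
  ultimately show ?thesis
    by (simp add: grid_graph_def cartesian_product_def)
qed

lemma grid_graph_edge_iff:
  "{a, b} \<in> edges (grid_graph m n) \<longleftrightarrow> a \<in> {..<m} \<times> {..<n} \<and> b \<in> {..<m} \<times> {..<n} \<and>
    (fst b = Suc (fst a) \<and> snd a = snd b \<or> fst a = Suc (fst b) \<and> snd a = snd b \<or>
     snd b = Suc (snd a) \<and> fst a = fst b \<or> snd a = Suc (snd b) \<and> fst a = fst b)"
  by (cases a; cases b) (auto simp: edges_grid_graph doubleton_eq_iff)

text \<open>The spanning tree consists of the first row and all the columns.\<close>

definition grid_parent :: "nat \<times> nat \<Rightarrow> nat \<times> nat" where
  "grid_parent v = (if fst v = 0 then (0, snd v - 1) else (fst v - 1, snd v))"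

text \<open>Column edges and first-row edges all join a vertex to its parent. Each of the other
  \<open>m - 1\<close> rows contributes its \<open>n - 1\<close> edges.\<close>

lemma card_grid_graph_nontree_edges:
  assumes "m \<ge> 2" "n \<ge> 2"
  shows "card (edges (grid_graph m n) - (\<lambda>v. {v, grid_parent v}) ` (verts (grid_graph m n) - {(0, 0)}))
    = (m - 1) * (n - 1)"
proof -
  let ?f = "\<lambda>(i, j). {(Suc i, j), (Suc i, Suc j)}"
  have "edges (grid_graph m n) - (\<lambda>v. {v, grid_parent v}) ` (verts (grid_graph m n) - {(0, 0)})
      = ?f ` ({..<m - 1} \<times> {..<n - 1})" (is "?E - ?T = ?N")
  proof (intro equalityI subsetI)
    fix e assume e: "e \<in> ?E - ?T"
    have tree: "e \<noteq> {v, grid_parent v}" if "v \<in> {..<m} \<times> {..<n}" "v \<noteq> (0, 0)" for v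
      using e that by (auto simp: verts_grid_graph)
    from e consider i j where "e = {(i, j), (Suc i, j)}" "Suc i < m" "j < n"
      | i j where "e = {(i, j), (i, Suc j)}" "i < m" "Suc j < n"
      unfolding edges_grid_graph by blast
    then show "e \<in> ?N"
    proof cases
      case (1 i j)
      then show ?thesis
        using tree[of "(Suc i, j)"] by (auto simp: grid_parent_def insert_commute)
    next
      case (2 i j)
      then have "i \<noteq> 0"
        using tree[of "(0, Suc j)"] by (auto simp: grid_parent_def insert_commute)
      then obtain i' where "i = Suc i'" by (cases i) auto
      with 2 show ?thesis
        by (intro image_eqI[of _ _ "(i', j)"]) auto
    qed
  next
    fix e assume "e \<in> ?N"
    then obtain i j where e: "e = {(Suc i, j), (Suc i, Suc j)}" "i < m - 1" "j < n - 1" by auto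
    then have "e \<in> ?E" unfolding e(1) by (auto simp: grid_graph_edge_iff)
    moreover have "e \<noteq> {v, grid_parent v}" for v
      unfolding e(1) by (cases v) (auto simp: grid_parent_def doubleton_eq_iff)
    ultimately show "e \<in> ?E - ?T" by blast
  qed
  moreover have "inj_on ?f ({..<m - 1} \<times> {..<n - 1})"
    by (auto simp: inj_on_def doubleton_eq_iff)
  ultimately show ?thesis
    by (simp add: card_image card_cartesian_product)
qed

theorem theorem4p16:
  fixes m n :: nat
  assumes "m \<ge> 2" and "n \<ge> 2"
  shows "complex_dim (total_2_cut_complex (grid_graph m n)) = int (m * n) - 3 \<and>
    geometric_realization (total_2_cut_complex (grid_graph m n))
      homotopy_equivalent_space wedge_of_spheres ((m - 1) * (n - 1)) (m * n - 4)"
proof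
  have fin: "finite (verts (grid_graph m n))" and card: "card (verts (grid_graph m n)) = m * n"
    by (simp_all add: verts_grid_graph card_cartesian_product)
  have "complex_dim (total_2_cut_complex (grid_graph m n)) = int (card (verts (grid_graph m n))) - 3"
  proof (rule complex_dim_total_2_cut_complex[OF fin, of "(0, 0)" "(1, 1)"])
    show "{(0, 0), (1, 1)} \<notin> edges (grid_graph m n)"
      unfolding grid_graph_edge_iff by simp
  qed (use assms in \<open>auto simp: verts_grid_graph\<close>)
  then show "complex_dim (total_2_cut_complex (grid_graph m n)) = int (m * n) - 3"
    by (simp only: card)
  \<comment> \<open>Ensures that the truncated subtraction in \<open>m * n - 4\<close> is
    genuine.\<close>
  have "2 * 2 \<le> m * n"
    using assms by (intro mult_le_mono)
  \<comment> \<open>The chessboard colouring, which excludes triangles.\<close>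
  have parity: "even (fst a + snd a) \<longleftrightarrow> odd (fst b + snd b)" if "{a, b} \<in> edges (grid_graph m n)" for a b
    using that unfolding grid_graph_edge_iff by auto
  have "geometric_realization (total_2_cut_complex (grid_graph m n)) homotopy_equivalent_space
    wedge_of_spheres (card (edges (grid_graph m n) -
      (\<lambda>v. {v, grid_parent v}) ` (verts (grid_graph m n) - {(0, 0)}))) (m * n - 4)"
  \<comment> \<open>The rank is the row-major position: a parent sits one place or one full row of
    \<open>n\<close> places earlier.\<close>
  proof (rule homotopy_equivalent_total_2_cut_complex[where rank = "\<lambda>v. fst v * n + snd v"])
    show "finite (verts (grid_graph m n))" by (rule fin)
    show "(0, 0) \<in> verts (grid_graph m n)"
      using assms by (simp add: verts_grid_graph)
    show "card (verts (grid_graph m n)) = m * n - 4 + 4"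
      using card \<open>2 * 2 \<le> m * n\<close> by simp
    show "\<exists>a\<in>verts (grid_graph m n). \<exists>b\<in>verts (grid_graph m n). e = {a, b} \<and> a \<noteq> b"
      if "e \<in> edges (grid_graph m n)" for e
      using that unfolding edges_grid_graph verts_grid_graph by fastforce
    show "{a, c} \<notin> edges (grid_graph m n)"
      if "{a, b} \<in> edges (grid_graph m n)" "{b, c} \<in> edges (grid_graph m n)" for a b c
      using parity[OF that(1)] parity[OF that(2)] parity[of a c] by blast
    show "inj_on (\<lambda>v. fst v * n + snd v) (verts (grid_graph m n))"
    proof (rule inj_on_inverseI[where g = "\<lambda>r. (r div n, r mod n)"])
      fix v assume "v \<in> verts (grid_graph m n)"
      then have "snd v < n" by (auto simp: verts_grid_graph)
      then show "((fst v * n + snd v) div n, (fst v * n + snd v) mod n) = v"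
        by simp
    qed
    fix v :: "nat \<times> nat"
    show "grid_parent v = (0, 0)" if "{(0, 0), v} \<in> edges (grid_graph m n)"
      using that unfolding grid_graph_edge_iff by (auto simp: grid_parent_def)
    assume "v \<in> verts (grid_graph m n) - {(0, 0)}"
    moreover obtain i j where "v = (i, j)" by (cases v)
    ultimately have v: "v = (i, j)" "i < m" "j < n" "i \<noteq> 0 \<or> j \<noteq> 0"
      by (auto simp: verts_grid_graph)
    show "grid_parent v \<in> verts (grid_graph m n)"
      using v by (auto simp: grid_parent_def verts_grid_graph)
    show "{v, grid_parent v} \<in> edges (grid_graph m n)"
      using v unfolding grid_graph_edge_iff by (auto simp: grid_parent_def)
    show "fst (grid_parent v) * n + snd (grid_parent v) < fst v * n + snd v"
      using v by (cases i) (auto simp: grid_parent_def)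
  qed
  then show "geometric_realization (total_2_cut_complex (grid_graph m n))
      homotopy_equivalent_space wedge_of_spheres ((m - 1) * (n - 1)) (m * n - 4)"
    by (simp only: card_grid_graph_nontree_edges[OF assms])
qed

end
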